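(* Let $n\ge 4$ and let $A$ be a nonempty subset of $[n]=\{1,\dots,n\}$ such that $QJ(n,A)$ has at least 4 vertices. Then $QJ(n,A)$ is paired 2-coverable.
   Context: The Johnson graph $J(n,k)$ has as vertices the $k$-subsets of $[n]$, two being adjacent iff they share exactly $k-1$ elements. For a nonempty $A=\{a_1<a_2<\dots<a_m\}\subseteq[n]$, the graph $QJ(n,A)$ is formed by taking, for each $i$, a copy of $J(n,a_i)$ (called level $i$), and additionally joining a vertex $u$ of level $i$ to a vertex $v$ of level $i+1$ whenever $u\subseteq v$ (for $1\le i<m$); there are no other edges. A graph $G$ is \emph{paired 2-coverable} if for any four distinct vertices $u,v,x,y$ of $G$ there exist two vertex-disjoint paths $P$ and $Q$ in $G$ such that $P$ has endpoints $u$ and $v$, $Q$ has endpoints $x$ and $y$, and $V(P)\cup V(Q)=V(G)$. *)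

theory Defs
  imports Main
begin

definition is_path :: "'a set \<Rightarrow> ('a \<Rightarrow> 'a \<Rightarrow> bool) \<Rightarrow> 'a list \<Rightarrow> bool" where
  "is_path V E P \<longleftrightarrow> P \<noteq> [] \<and> distinct P \<and> set P \<subseteq> V \<and>
     (\<forall>i. Suc i < length P \<longrightarrow> E (P ! i) (P ! Suc i))"

definition paired_2_coverable :: "'a set \<Rightarrow> ('a \<Rightarrow> 'a \<Rightarrow> bool) \<Rightarrow> bool" where
  "paired_2_coverable V E \<longleftrightarrow>
     (\<forall>u\<in>V. \<forall>v\<in>V. \<forall>x\<in>V. \<forall>y\<in>V. distinct [u, v, x, y] \<longrightarrow>
        (\<exists>P Q. is_path V E P \<and> is_path V E Q \<and>
               hd P = u \<and> last P = v \<and> hd Q = x \<and> last Q = y \<and>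
               set P \<inter> set Q = {} \<and> set P \<union> set Q = V))"

definition johnson_verts :: "nat \<Rightarrow> nat \<Rightarrow> nat set set" where
  "johnson_verts n k = {S. S \<subseteq> {1..n} \<and> card S = k}"

definition johnson_adj :: "nat \<Rightarrow> nat set \<Rightarrow> nat set \<Rightarrow> bool" where
  "johnson_adj k S T \<longleftrightarrow> card (S \<inter> T) = k - 1 \<and> S \<noteq> T"

definition lev :: "nat set \<Rightarrow> nat \<Rightarrow> nat" where
  "lev A i = sorted_list_of_set A ! i"

(* QJ(n,A). Since the levels J(n,a_i) have pairwise distinct subset sizes, the disjoint union
   of the levels is represented by the set of all subsets of [n] whose size lies in A;
   the level of S is the index i with a_i = card S. *)
definition QJ_verts :: "nat \<Rightarrow> nat set \<Rightarrow> nat set set" where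
  "QJ_verts n A = (\<Union>i<card A. johnson_verts n (lev A i))"

definition QJ_adj :: "nat \<Rightarrow> nat set \<Rightarrow> nat set \<Rightarrow> nat set \<Rightarrow> bool" where
  "QJ_adj n A S T \<longleftrightarrow>
     (\<exists>i<card A. S \<in> johnson_verts n (lev A i) \<and> T \<in> johnson_verts n (lev A i)
                  \<and> johnson_adj (lev A i) S T)
   \<or> (\<exists>i. Suc i < card A \<and> S \<in> johnson_verts n (lev A i)
            \<and> T \<in> johnson_verts n (lev A (Suc i)) \<and> S \<subseteq> T)
   \<or> (\<exists>i. Suc i < card A \<and> T \<in> johnson_verts n (lev A i)
            \<and> S \<in> johnson_verts n (lev A (Suc i)) \<and> T \<subseteq> S)"

end

theory Submission
  imports Defs
begin

text \<open>
  The family is enlarged so that it becomes closed under splitting off a ground element: the level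
  set \<open>A\<close> may be any set of naturals, including 0. The graph on \<open>{1..n}\<close> is then the union of the
  sets avoiding \<open>n\<close> (level set \<open>A\<close>) and the sets containing \<open>n\<close> (level set \<open>A - 1\<close>), both being
  members of the family over \<open>{1..n-1}\<close>. The property carried through the induction is paired
  2-coverability together with Hamilton-connectedness (which follows from it if there are at least
  four vertices). If all four endpoints lie in one half, the other half is inserted as a detour
  replacing an edge; otherwise paths are joined along crossing edges. Crossing edges that avoid the
  endpoints exist as soon as one half has four vertices with pairwise distinct sets of at least
  three neighbours in the other half.

  The exceptions are graphs in which every vertex has at most one non-neighbour, where two short
  paths are extended by inserting the remaining vertices one at a time, and some graphs with
  \<open>n = 3\<close> and at most eight vertices, which are searched exhaustively.
\<close>

section \<open>Hamiltonian paths and gluing\<close>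

text \<open>The vertex set of the path is an exact parameter, so that gluing paths becomes a matter
  of disjoint unions. A one-vertex path has \<open>u = v\<close>.\<close>

definition ham :: "('a \<Rightarrow> 'a \<Rightarrow> bool) \<Rightarrow> 'a set \<Rightarrow> 'a \<Rightarrow> 'a \<Rightarrow> bool" where
  "ham E V u v \<longleftrightarrow>
     (\<exists>P. P \<noteq> [] \<and> distinct P \<and> set P = V \<and> successively E P \<and> hd P = u \<and> last P = v)"

definition ham2 :: "('a \<Rightarrow> 'a \<Rightarrow> bool) \<Rightarrow> 'a set \<Rightarrow> 'a \<Rightarrow> 'a \<Rightarrow> 'a \<Rightarrow> 'a \<Rightarrow> bool" where
  "ham2 E V u v x y \<longleftrightarrow> (\<exists>W\<subseteq>V. ham E W u v \<and> ham E (V - W) x y)"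

text \<open>On fewer than four vertices the second clause is vacuous and the first one carries the
  induction. The empty graph and a single vertex qualify, so a half of a split graph may be that
  small.\<close>

definition linkable :: "('a \<Rightarrow> 'a \<Rightarrow> bool) \<Rightarrow> 'a set \<Rightarrow> bool" where
  "linkable E V \<longleftrightarrow>
     (\<forall>u\<in>V. \<forall>v\<in>V. u \<noteq> v \<longrightarrow> ham E V u v) \<and>
     (\<forall>u\<in>V. \<forall>v\<in>V. \<forall>x\<in>V. \<forall>y\<in>V. distinct [u, v, x, y] \<longrightarrow> ham2 E V u v x y)"

lemma linkable_ham: "linkable E V \<Longrightarrow> u \<in> V \<Longrightarrow> v \<in> V \<Longrightarrow> u \<noteq> v \<Longrightarrow> ham E V u v"
  unfolding linkable_def by blast

lemma linkable_ham2:
  "linkable E V \<Longrightarrow> u \<in> V \<Longrightarrow> v \<in> V \<Longrightarrow> x \<in> V \<Longrightarrow> y \<in> V \<Longrightarrow> distinct [u, v, x, y] \<Longrightarrow>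
    ham2 E V u v x y"
  unfolding linkable_def by blast

lemma ham_single: "ham E {u} u u"
  unfolding ham_def by (rule exI[of _ "[u]"]) simp

lemma ham_ends: "ham E V u v \<Longrightarrow> u \<in> V \<and> v \<in> V"
  unfolding ham_def by auto

lemma ham_join:
  assumes "ham E V u a" "ham E W b v" "E a b" "V \<inter> W = {}"
  shows "ham E (V \<union> W) u v"
proof -
  obtain P Q where "P \<noteq> [] \<and> distinct P \<and> set P = V \<and> successively E P \<and> hd P = u \<and> last P = a"
    "Q \<noteq> [] \<and> distinct Q \<and> set Q = W \<and> successively E Q \<and> hd Q = b \<and> last Q = v"
    using assms(1,2) unfolding ham_def by blast
  then show ?thesis
    unfolding ham_def using assms(3,4)
    by (intro exI[of _ "P @ Q"]) (auto simp: successively_append_iff)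
qed

lemma ham_Cons: "ham E W b v \<Longrightarrow> E u b \<Longrightarrow> u \<notin> W \<Longrightarrow> ham E (insert u W) u v"
  using ham_join[OF ham_single, of E W b v u] by simp

lemma ham_edge: "E u v \<Longrightarrow> u \<noteq> v \<Longrightarrow> ham E {u, v} u v"
  by (rule ham_Cons[OF ham_single]) auto

text \<open>All detours and insertions below are made at the first edge of a path.\<close>

lemma ham_first_edge:
  assumes "ham E V u v" "u \<noteq> v"
  obtains w where "w \<in> V" "w \<noteq> u" "E u w" "ham E (V - {u}) w v"
proof -
  obtain P where P: "P \<noteq> []" "distinct P" "set P = V" "successively E P" "hd P = u" "last P = v"
    using assms(1) unfolding ham_def by blast
  then obtain Q where Q: "P = u # Q" by (cases P) auto
  with P assms have "Q \<noteq> []" by auto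
  then have "hd Q \<in> set Q" by simp
  moreover have "ham E (V - {u}) (hd Q) v"
    unfolding ham_def using P Q \<open>Q \<noteq> []\<close>
    by (intro exI[of _ Q]) (auto simp: successively_Cons)
  ultimately show thesis
    using P Q \<open>Q \<noteq> []\<close> by (intro that[of "hd Q"]) (auto simp: successively_Cons)
qed

lemma ham_sym:
  assumes "symp E" "ham E V u v"
  shows "ham E V v u"
proof -
  obtain P where P: "P \<noteq> []" "distinct P" "set P = V" "successively E P" "hd P = u" "last P = v"
    using assms(2) unfolding ham_def by blast
  moreover have "successively (\<lambda>x y. E y x) P"
    using P(4) by (rule successively_mono) (use assms(1) in \<open>auto dest: sympD\<close>)
  ultimately show ?thesis
    unfolding ham_def by (intro exI[of _ "rev P"]) (auto simp: hd_rev last_rev)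
qed

lemma ham_image:
  assumes "ham E V u v" "inj_on f V" "\<And>a b. a \<in> V \<Longrightarrow> b \<in> V \<Longrightarrow> E a b \<Longrightarrow> F (f a) (f b)"
  shows "ham F (f ` V) (f u) (f v)"
proof -
  obtain P where P: "P \<noteq> []" "distinct P" "set P = V" "successively E P" "hd P = u" "last P = v"
    using assms(1) unfolding ham_def by blast
  have "successively (\<lambda>a b. F (f a) (f b)) P"
    using P(4) by (rule successively_mono) (use assms(3) P(3) in auto)
  then show ?thesis
    unfolding ham_def using P assms(2)
    by (intro exI[of _ "map f P"]) (auto simp: distinct_map successively_map hd_map last_map)
qed

lemma ham2I: "ham E W u v \<Longrightarrow> ham E W' x y \<Longrightarrow> W \<inter> W' = {} \<Longrightarrow> V = W \<union> W' \<Longrightarrow> ham2 E V u v x y"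
  unfolding ham2_def by (intro exI[of _ W]) (auto simp: Un_Diff Diff_triv Int_commute)

lemma ham2E:
  assumes "ham2 E V u v x y"
  obtains W W' where "ham E W u v" "ham E W' x y" "W \<inter> W' = {}" "V = W \<union> W'"
  using assms unfolding ham2_def by blast

lemma ham2_swap: "ham2 E V u v x y \<Longrightarrow> ham2 E V x y u v"
  by (elim ham2E, rule ham2I[rotated]) auto

lemma ham2_rev1: "symp E \<Longrightarrow> ham2 E V u v x y \<Longrightarrow> ham2 E V v u x y"
  by (elim ham2E, rule ham2I) (auto intro: ham_sym)

lemma ham2_rev2: "symp E \<Longrightarrow> ham2 E V u v x y \<Longrightarrow> ham2 E V u v y x"
  by (elim ham2E, rule ham2I) (auto intro: ham_sym)

lemma ham2_image:
  assumes "ham2 E V u v x y" "inj_on f V" "\<And>a b. a \<in> V \<Longrightarrow> b \<in> V \<Longrightarrow> E a b \<Longrightarrow> F (f a) (f b)"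
  shows "ham2 F (f ` V) (f u) (f v) (f x) (f y)"
  using assms(1)
proof (rule ham2E)
  fix W W' assume W: "ham E W u v" "ham E W' x y" "W \<inter> W' = {}" "V = W \<union> W'"
  show ?thesis
  proof (rule ham2I)
    show "ham F (f ` W) (f u) (f v)" "ham F (f ` W') (f x) (f y)"
      using W assms(2,3) by (auto intro!: ham_image[of E] intro: inj_on_subset)
    show "f ` W \<inter> f ` W' = {}"
      using W assms(2) by (auto simp: inj_on_def)
  qed (use W in auto)
qed

text \<open>Paths are transported forwards along \<open>f\<close>. The maps in question are the
  coding of subsets of \<open>{1, 2, 3}\<close>, complementation, and adjoining the largest
  element.\<close>

lemma linkable_image:
  assumes "linkable E V" "inj_on f V" "\<And>a b. a \<in> V \<Longrightarrow> b \<in> V \<Longrightarrow> E a b \<Longrightarrow> F (f a) (f b)"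
  shows "linkable F (f ` V)"
  unfolding linkable_def
proof (intro conjI ballI impI)
  fix u v assume "u \<in> f ` V" "v \<in> f ` V" "u \<noteq> v"
  then obtain u' v' where "u' \<in> V" "v' \<in> V" "u = f u'" "v = f v'" "u' \<noteq> v'" by auto
  then show "ham F (f ` V) u v"
    using assms by (auto simp: linkable_def intro!: ham_image[of E])
next
  fix u v x y assume "u \<in> f ` V" "v \<in> f ` V" "x \<in> f ` V" "y \<in> f ` V" "distinct [u, v, x, y]"
  then obtain u' v' x' y' where *: "u' \<in> V" "v' \<in> V" "x' \<in> V" "y' \<in> V"
    "u = f u'" "v = f v'" "x = f x'" "y = f y'" "distinct [u', v', x', y']" by auto
  then have "ham2 E V u' v' x' y'" using assms(1) unfolding linkable_def by blast
  then show "ham2 F (f ` V) u v x y" unfolding * by (rule ham2_image) (use assms in auto)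
qed

text \<open>The forbidden elements form a list whose length alone is compared, so repetitions among
  them call for no case distinction.\<close>

lemma ex_avoiding:
  assumes "length xs < card B"
  obtains b where "b \<in> B" "b \<notin> set xs"
proof -
  have "\<not> B \<subseteq> set xs"
    using assms card_mono[of "set xs" B] card_length[of xs] by auto
  then show thesis using that by blast
qed

text \<open>Any path avoiding u and v supplies an edge xy at which a Hamiltonian path from u to v
  can be split.\<close>
lemma linkableI:
  assumes "finite V" "symp E" "card V \<ge> 4"
    and h2: "\<And>u v x y. u \<in> V \<Longrightarrow> v \<in> V \<Longrightarrow> x \<in> V \<Longrightarrow> y \<in> V \<Longrightarrow> distinct [u, v, x, y] \<Longrightarrow>
      ham2 E V u v x y"
  shows "linkable E V"
  unfolding linkable_def
proof (intro conjI ballI impI)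
  fix u v assume uv: "u \<in> V" "v \<in> V" "u \<noteq> v"
  obtain x where x: "x \<in> V" "x \<notin> {u, v}" using ex_avoiding[of "[u, v]" V] assms(3) by auto
  obtain y where y: "y \<in> V" "y \<notin> {u, v, x}"
    using ex_avoiding[of "[u, v, x]" V] assms(3) by auto
  have "ham2 E V u v x y" by (rule h2) (use uv x y in auto)
  then obtain W W' where W: "ham E W u v" "ham E W' x y" "W \<inter> W' = {}" "V = W \<union> W'"
    by (rule ham2E)
  obtain w where w: "w \<in> W'" "w \<noteq> x" "E x w" using ham_first_edge[OF W(2)] y by blast
  have "distinct [u, x, w, v]" "w \<in> V" using w W(3,4) ham_ends[OF W(1)] uv x by auto
  then have "ham2 E V u x w v" using uv x by (intro h2) auto
  then obtain Z Z' where "ham E Z u x" "ham E Z' w v" "Z \<inter> Z' = {}" "V = Z \<union> Z'"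
    by (rule ham2E)
  then show "ham E V u v" using ham_join[of E Z u x Z' w v] w by simp
qed (use h2 in blast)

section \<open>Gluing two linkable graphs along crossing edges\<close>

text \<open>Detour: the first edge \<open>u w\<close> of the path is replaced by a crossing from
  \<open>u\<close> into \<open>V1\<close>, a Hamiltonian path of \<open>V1\<close> and a crossing
  back to \<open>w\<close>. The set \<open>W\<close> may be a proper part of \<open>V0\<close>,
  because one of two paths covering \<open>V0\<close> is to be extended.\<close>

lemma glue_ham_same:
  assumes V: "V0 \<inter> V1 = {}" "linkable E V1" "ham E W u v" "u \<noteq> v" "W \<subseteq> V0" "symp E"
    and lift: "\<And>a b. a \<in> V0 \<Longrightarrow> b \<in> V0 \<Longrightarrow> a \<noteq> b \<Longrightarrow> E a b \<Longrightarrow>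
      \<exists>a'\<in>V1. \<exists>b'\<in>V1. a' \<noteq> b' \<and> E a a' \<and> E b b'"
  shows "ham E (W \<union> V1) u v"
proof -
  obtain w where w: "w \<in> W" "w \<noteq> u" "E u w" "ham E (W - {u}) w v"
    using ham_first_edge[OF V(3,4)] .
  have u: "u \<in> W" using ham_ends[OF V(3)] by simp
  then obtain u' w' where l: "u' \<in> V1" "w' \<in> V1" "u' \<noteq> w'" "E u u'" "E w w'"
    using lift[of u w] w V(5) by blast
  have "ham E V1 u' w'" using V(2) l unfolding linkable_def by blast
  then have "ham E (V1 \<union> (W - {u})) u' v"
    by (rule ham_join[OF _ w(4)]) (use l V in \<open>auto dest: sympD\<close>)
  then have "ham E (insert u (V1 \<union> (W - {u}))) u v"
    by (rule ham_Cons) (use l V u in auto)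
  moreover have "insert u (V1 \<union> (W - {u})) = W \<union> V1" using u by auto
  ultimately show ?thesis by simp
qed

text \<open>What is needed of the edges between two linkable graphs in order that their union is
  linkable: each edge on one side can be replaced by a detour through the other side, and the
  endpoints of the prescribed paths do not block all crossings.\<close>
definition bridged :: "('a \<Rightarrow> 'a \<Rightarrow> bool) \<Rightarrow> 'a set \<Rightarrow> 'a set \<Rightarrow> bool" where
  "bridged E V0 V1 \<longleftrightarrow>
     (\<forall>a\<in>V0. \<forall>b\<in>V0. a \<noteq> b \<longrightarrow> E a b \<longrightarrow> (\<exists>a'\<in>V1. \<exists>b'\<in>V1. a' \<noteq> b' \<and> E a a' \<and> E b b')) \<and>
     (\<forall>u v x y. \<exists>a\<in>V0 - {u, v, x}. \<exists>a'\<in>V1 - {y}. E a a') \<and>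
     (\<forall>u v x y. \<exists>a\<in>V0 - {u, v}. \<exists>b\<in>V0 - {u, v, a}. \<exists>a'\<in>V1 - {x, y}. \<exists>b'\<in>V1 - {x, y, a'}.
        E a a' \<and> E b b')"

text \<open>The digits count the endpoints in \<open>V0\<close> and in \<open>V1\<close>. The two
  paths are found inside \<open>V0\<close>, and the one from \<open>u\<close> to \<open>v\<close>
  absorbs \<open>V1\<close> by a detour.\<close>

lemma glue_ham2_40:
  assumes "V0 \<inter> V1 = {}" "linkable E V0" "linkable E V1" "bridged E V0 V1" "symp E"
    "u \<in> V0" "v \<in> V0" "x \<in> V0" "y \<in> V0" "distinct [u, v, x, y]"
  shows "ham2 E (V0 \<union> V1) u v x y"
proof -
  have "ham2 E V0 u v x y" by (rule linkable_ham2) (use assms in simp_all)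
  then obtain W W' where W: "ham E W u v" "ham E W' x y" "W \<inter> W' = {}" "V0 = W \<union> W'"
    by (rule ham2E)
  have "ham E (W \<union> V1) u v"
    by (rule glue_ham_same[OF assms(1,3) W(1) _ _ assms(5)])
      (use assms W in \<open>auto simp: bridged_def\<close>)
  then show ?thesis by (rule ham2I[OF _ W(2)]) (use W assms in auto)
qed

text \<open>The path from \<open>x\<close> first runs to an auxiliary vertex \<open>a\<close> of
  \<open>V0\<close>, crosses to \<open>a'\<close> and traverses all of \<open>V1\<close> to
  \<open>y\<close>. The second clause of \<open>bridged\<close> keeps \<open>a\<close> away from the
  endpoints in \<open>V0\<close> and \<open>a'\<close> away from \<open>y\<close>.\<close>

lemma glue_ham2_31:
  assumes "V0 \<inter> V1 = {}" "linkable E V0" "linkable E V1" "bridged E V0 V1"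
    "u \<in> V0" "v \<in> V0" "x \<in> V0" "y \<in> V1" "distinct [u, v, x, y]"
  shows "ham2 E (V0 \<union> V1) u v x y"
proof -
  obtain a a' where a: "a \<in> V0 - {u, v, x}" "a' \<in> V1 - {y}" "E a a'"
    using assms(4) unfolding bridged_def by meson
  then have "ham2 E V0 u v x a" using assms by (intro linkable_ham2) auto
  then obtain W W' where W: "ham E W u v" "ham E W' x a" "W \<inter> W' = {}" "V0 = W \<union> W'"
    by (rule ham2E)
  have "ham E V1 a' y" using assms a by (intro linkable_ham) auto
  then have "ham E (W' \<union> V1) x y" by (rule ham_join[OF W(2)]) (use a W assms in auto)
  then show ?thesis by (rule ham2I[OF W(1)]) (use W assms in auto)
qed

lemma glue_ham2_parallel:
  assumes "V0 \<inter> V1 = {}" "linkable E V0" "linkable E V1"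
    "u \<in> V0" "v \<in> V0" "x \<in> V1" "y \<in> V1" "distinct [u, v, x, y]"
  shows "ham2 E (V0 \<union> V1) u v x y"
  by (rule ham2I[of _ V0 _ _ V1]) (use assms in \<open>auto intro: linkable_ham\<close>)

text \<open>Both paths change sides. Two disjoint crossing edges avoiding the endpoints are fixed,
  and each half is covered by two paths leading from its endpoints to these crossings.\<close>

lemma glue_ham2_crossing:
  assumes "V0 \<inter> V1 = {}" "linkable E V0" "linkable E V1" "bridged E V0 V1"
    "u \<in> V0" "v \<in> V1" "x \<in> V0" "y \<in> V1" "distinct [u, v, x, y]"
  shows "ham2 E (V0 \<union> V1) u v x y"
proof -
  obtain a b a' b' where a: "a \<in> V0 - {u, x}" "b \<in> V0 - {u, x, a}" "a' \<in> V1 - {v, y}"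
    "b' \<in> V1 - {v, y, a'}" "E a a'" "E b b'"
    using assms(4) unfolding bridged_def by meson
  have "ham2 E V0 u a x b" "ham2 E V1 a' v b' y" using assms a by (auto intro!: linkable_ham2)
  then obtain W W' Z Z' where
    W: "ham E W u a" "ham E W' x b" "W \<inter> W' = {}" "V0 = W \<union> W'" and
    Z: "ham E Z a' v" "ham E Z' b' y" "Z \<inter> Z' = {}" "V1 = Z \<union> Z'"
    by (elim ham2E)
  have "ham E (W \<union> Z) u v" by (rule ham_join[OF W(1) Z(1)]) (use a W Z assms in auto)
  moreover have "ham E (W' \<union> Z') x y" by (rule ham_join[OF W(2) Z(2)]) (use a W Z assms in auto)
  ultimately show ?thesis by (rule ham2I) (use W Z assms in auto)
qed

lemma linkable_union:
  assumes disj: "V0 \<inter> V1 = {}" and fin: "finite (V0 \<union> V1)" and E: "symp E"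
    and lk: "linkable E V0" "linkable E V1"
    and br: "bridged E V0 V1" "bridged E V1 V0"
  shows "linkable E (V0 \<union> V1)"
proof (rule linkableI[OF fin E])
  let ?V = "V0 \<union> V1"
  \<comment> \<open>\<open>linkableI\<close> asks for four vertices. The second clause of
    \<open>bridged\<close>, with all three excluded vertices equal to the one already chosen, gives
    a second vertex in each half.\<close>
  obtain u where u: "u \<in> V0" using br(1) unfolding bridged_def by blast
  obtain v where v: "v \<in> V0 - {u, u, u}" using br(1) unfolding bridged_def by meson
  obtain x where x: "x \<in> V1" using br(1) unfolding bridged_def by blast
  obtain y where y: "y \<in> V1 - {x, x, x}" using br(2) unfolding bridged_def by meson
  have "card {u, v, x, y} \<le> card ?V" by (rule card_mono) (use fin u v x y in auto)
  moreover have "distinct [u, v, x, y]" using u v x y disj by auto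
  then have "card {u, v, x, y} = 4" using distinct_card[of "[u, v, x, y]"] by simp
  ultimately show "card ?V \<ge> 4" by simp
  have disj': "V1 \<inter> V0 = {}" using disj by auto
  \<comment> \<open>Stated for arbitrary halves so that \<open>V0\<close> and \<open>V1\<close> can
    be exchanged: the half containing the first endpoint plays the role of \<open>W0\<close>. The
    other endpoints give eight cases, reduced to the gluing lemmas by exchanging or reversing the
    paths.\<close>
  have fst: "ham2 E (W0 \<union> W1) u v x y"
    if W: "W0 \<inter> W1 = {}" "linkable E W0" "linkable E W1" "bridged E W0 W1" "bridged E W1 W0"
      and "u \<in> W0" and vxy: "v \<in> W0 \<union> W1" "x \<in> W0 \<union> W1" "y \<in> W0 \<union> W1" and d: "distinct [u, v, x, y]"
    for W0 W1 u v x y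
  proof -
    have W': "W1 \<inter> W0 = {}" using W by auto
    note perm = ham2_swap[of E] ham2_rev1[OF E] ham2_rev2[OF E]
    note c31 = glue_ham2_31[OF W(1-4)] and c13 = glue_ham2_31[OF W' W(3,2,5)]
    note cr = glue_ham2_crossing[OF W(1-4)]
    consider "v \<in> W0" "x \<in> W0" "y \<in> W0" | "v \<in> W0" "x \<in> W0" "y \<in> W1"
      | "v \<in> W0" "x \<in> W1" "y \<in> W0" | "v \<in> W1" "x \<in> W0" "y \<in> W0"
      | "v \<in> W0" "x \<in> W1" "y \<in> W1" | "v \<in> W1" "x \<in> W1" "y \<in> W0"
      | "v \<in> W1" "x \<in> W0" "y \<in> W1" | "v \<in> W1" "x \<in> W1" "y \<in> W1"
      using vxy by blast
    then show ?thesis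
    proof cases
      case 1 then show ?thesis using glue_ham2_40[OF W(1-4) E] \<open>u \<in> W0\<close> d by blast
    next
      case 2 then show ?thesis using c31 \<open>u \<in> W0\<close> d by blast
    next
      case 3
      then have "ham2 E (W0 \<union> W1) u v y x" using c31[of u v y x] \<open>u \<in> W0\<close> d by auto
      then show ?thesis by (rule perm(3))
    next
      case 4
      then have "ham2 E (W0 \<union> W1) x y u v" using c31[of x y u v] \<open>u \<in> W0\<close> d by auto
      then show ?thesis by (rule perm(1))
    next
      case 5 then show ?thesis using glue_ham2_parallel[OF W(1-3)] \<open>u \<in> W0\<close> d by blast
    next
      case 6
      then have "ham2 E (W0 \<union> W1) u v y x" using cr[of u v y x] \<open>u \<in> W0\<close> d by auto
      then show ?thesis by (rule perm(3))
    next
      case 7 then show ?thesis using cr[of u v x y] \<open>u \<in> W0\<close> d by blast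
    next
      case 8
      then have "ham2 E (W0 \<union> W1) x y v u"
        using c13[of x y v u] \<open>u \<in> W0\<close> d by (auto simp: Un_commute)
      then show ?thesis by (rule perm(1)[OF perm(3)])
    qed
  qed
  fix u v x y
  assume "u \<in> ?V" "v \<in> ?V" "x \<in> ?V" "y \<in> ?V" "distinct [u, v, x, y]"
  then show "ham2 E ?V u v x y"
    using fst[OF disj lk br, of u v x y] fst[OF disj' lk(2,1) br(2,1), of u v x y]
    by (auto simp: Un_commute)
qed

section \<open>Crossing edges from a family of neighbourhoods\<close>

text \<open>Of four vertices in \<open>B\<close>, one survives the exclusion of three, and two
  survive the exclusion of two. The neighbourhoods of two survivors are different sets of size at
  least three, so the excluded vertices of \<open>V0\<close> cannot block both.\<close>

lemma bridged_by_neighbourhoods: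
  assumes E: "symp E" and B: "B \<subseteq> V1" "card B \<ge> 4"
    and N: "\<And>b. b \<in> B \<Longrightarrow> N b \<subseteq> V0" "\<And>b. b \<in> B \<Longrightarrow> card (N b) \<ge> 3"
      "\<And>a b. b \<in> B \<Longrightarrow> a \<in> N b \<Longrightarrow> E a b" "inj_on N B" "finite V0"
    and lift0: "\<And>a b. a \<in> V0 \<Longrightarrow> b \<in> V0 \<Longrightarrow> a \<noteq> b \<Longrightarrow> E a b \<Longrightarrow>
      \<exists>a'\<in>V1. \<exists>b'\<in>V1. a' \<noteq> b' \<and> E a a' \<and> E b b'"
    and lift1: "\<And>a b. a \<in> V1 \<Longrightarrow> b \<in> V1 \<Longrightarrow> a \<noteq> b \<Longrightarrow> E a b \<Longrightarrow>
      \<exists>a'\<in>V0. \<exists>b'\<in>V0. a' \<noteq> b' \<and> E a a' \<and> E b b'"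
  shows "bridged E V0 V1 \<and> bridged E V1 V0"
proof -
  have c3: "card {u, v, x} \<le> 3" for u v x :: 'a
    using card_length[of "[u, v, x]"] by simp
  have one: "\<exists>a'\<in>V1 - {u, v, x}. \<exists>a\<in>V0 - {y}. E a a'" for u v x y
  proof -
    obtain b where b: "b \<in> B" "b \<notin> {u, v, x}"
      using ex_avoiding[of "[u, v, x]" B] B(2) by auto
    obtain a where "a \<in> N b" "a \<notin> {y}"
      using ex_avoiding[of "[y]" "N b"] N(2)[OF b(1)] by auto
    then show ?thesis using b B(1) N by blast
  qed
  have two: "\<exists>a\<in>V0 - {u, v, x}. \<exists>a'\<in>V1 - {y}. E a a'" for u v x y
  proof -
    obtain b where b: "b \<in> B" "b \<notin> {y}" using ex_avoiding[of "[y]" B] B(2) by auto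
    obtain c where c: "c \<in> B" "c \<notin> {y, b}"
      using ex_avoiding[of "[y, b]" B] B(2) by auto
    \<comment> \<open>A set with at least three elements inside \<open>{u, v, x}\<close> equals it,
      which cannot happen for two different sets.\<close>
    have "\<exists>d\<in>{b, c}. \<not> N d \<subseteq> {u, v, x}"
    proof (rule ccontr)
      assume "\<not> ?thesis"
      then have "N b \<subseteq> {u, v, x}" "N c \<subseteq> {u, v, x}" by auto
      moreover have "card (N b) \<ge> 3" "card (N c) \<ge> 3" using N(2) b c by auto
      ultimately have "N b = {u, v, x}" "N c = {u, v, x}"
        using c3[of u v x] card_seteq[of "{u, v, x}"] by (meson finite.intros order_trans)+
      then show False using inj_onD[OF N(4), of b c] b c by auto
    qed
    then show ?thesis using b c B(1) N(1,3) by blast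
  qed
  have three: "\<exists>a\<in>V0 - {u, v}. \<exists>b\<in>V0 - {u, v, a}. \<exists>a'\<in>V1 - {x, y}. \<exists>b'\<in>V1 - {x, y, a'}.
        E a a' \<and> E b b'" for u v x y
  proof -
    obtain b where b: "b \<in> B" "b \<notin> {x, y}"
      using ex_avoiding[of "[x, y]" B] B(2) by auto
    obtain c where c: "c \<in> B" "c \<notin> {x, y, b}"
      using ex_avoiding[of "[x, y, b]" B] B(2) by auto
    obtain p where p: "p \<in> N b" "p \<notin> {u, v}"
      using ex_avoiding[of "[u, v]" "N b"] N(2)[OF b(1)] by auto
    obtain q where q: "q \<in> N c" "q \<notin> {u, v}"
      using ex_avoiding[of "[u, v]" "N c"] N(2)[OF c(1)] by auto
    \<comment> \<open>Distinct representatives outside \<open>{u, v}\<close>: if there were none,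
      both neighbourhoods would consist of exactly \<open>u\<close>, \<open>v\<close> and one common
      vertex.\<close>
    have "\<exists>p q. p \<in> N b \<and> q \<in> N c \<and> p \<notin> {u, v} \<and> q \<notin> {u, v} \<and> p \<noteq> q"
    proof (rule ccontr)
      assume *: "\<not> ?thesis"
      then have "p = q" using p q by blast
      with * p q have "N b \<subseteq> {u, v, p}" "N c \<subseteq> {u, v, p}" by blast+
      moreover have "card (N b) \<ge> 3" "card (N c) \<ge> 3" using N(2) b c by auto
      ultimately have "N b = {u, v, p}" "N c = {u, v, p}"
        using c3[of u v p] card_seteq[of "{u, v, p}"] by (meson finite.intros order_trans)+
      then show False using inj_onD[OF N(4), of b c] b c by auto
    qed
    then obtain p q where pq: "p \<in> N b" "q \<in> N c" "p \<notin> {u, v}" "q \<notin> {u, v}" "p \<noteq> q" by blast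
    then have "p \<in> V0 - {u, v}" "q \<in> V0 - {u, v, p}" "b \<in> V1 - {x, y}" "c \<in> V1 - {x, y, b}"
      "E p b" "E q c"
      using b c N(1,3) B(1) by auto
    then show ?thesis by blast
  qed
  have four: "\<exists>a\<in>V1 - {u, v}. \<exists>b\<in>V1 - {u, v, a}. \<exists>a'\<in>V0 - {x, y}. \<exists>b'\<in>V0 - {x, y, a'}.
        E a a' \<and> E b b'" for u v x y
  proof -
    obtain a b a' b' where "a \<in> V0 - {x, y}" "b \<in> V0 - {x, y, a}" "a' \<in> V1 - {u, v}"
      "b' \<in> V1 - {u, v, a'}" "E a a'" "E b b'"
      using three[of x y u v] by blast
    then show ?thesis using sympD[OF E] by blast
  qed
  have five: "\<exists>a\<in>V1 - {u, v, x}. \<exists>a'\<in>V0 - {y}. E a a'" for u v x y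
    using one[of u v x y] sympD[OF E] by blast
  have "bridged E V0 V1" unfolding bridged_def by (intro conjI allI ballI impI lift0 two three)
  moreover have "bridged E V1 V0" unfolding bridged_def by (intro conjI allI ballI impI lift1 four five)
  ultimately show ?thesis by simp
qed

section \<open>Graphs in which every vertex has at most one non-neighbour\<close>

lemma ham_insert:
  assumes "ham E W u v" "u \<noteq> v" "w \<notin> W" "\<And>a. a \<in> W \<Longrightarrow> E w a" "symp E"
  shows "ham E (insert w W) u v"
proof -
  obtain c where c: "c \<in> W" "c \<noteq> u" "E u c" "ham E (W - {u}) c v"
    using ham_first_edge[OF assms(1,2)] .
  have u: "u \<in> W" using ham_ends[OF assms(1)] by simp
  have "ham E (insert w (W - {u})) w v" by (rule ham_Cons[OF c(4)]) (use assms c in auto)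
  then have "ham E (insert u (insert w (W - {u}))) u v"
    by (rule ham_Cons) (use assms u in \<open>auto dest: sympD\<close>)
  moreover have "insert u (insert w (W - {u})) = insert w W" using u by auto
  ultimately show ?thesis by simp
qed

text \<open>A vertex outside the two paths has its only possible non-neighbour on at most one of
  them, so it can be inserted into the other one.\<close>
lemma linkable_near_complete:
  assumes fin: "finite V" and E: "symp E"
    and nn: "\<And>w a b. w \<in> V \<Longrightarrow> a \<in> V \<Longrightarrow> b \<in> V \<Longrightarrow> a \<noteq> w \<Longrightarrow> b \<noteq> w \<Longrightarrow> \<not> E w a \<Longrightarrow> \<not> E w b \<Longrightarrow>
      a = b"
    and h5: "\<And>u v. u \<in> V \<Longrightarrow> v \<in> V \<Longrightarrow> u \<noteq> v \<Longrightarrow> \<not> E u v \<Longrightarrow> card V \<ge> 5"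
    and h6: "\<And>u v x y. u \<in> V \<Longrightarrow> v \<in> V \<Longrightarrow> x \<in> V \<Longrightarrow> y \<in> V \<Longrightarrow> distinct [u, v, x, y] \<Longrightarrow>
      \<not> E u v \<Longrightarrow> \<not> E x y \<Longrightarrow> card V \<ge> 6"
  shows "linkable E V"
proof -
  have h2: "ham2 E V u v x y"
    if m: "u \<in> V" "v \<in> V" "x \<in> V" "y \<in> V" and d: "distinct [u, v, x, y]" for u v x y
  proof -
    have uv: "u \<noteq> v" and xy: "x \<noteq> y" using d by auto
    \<comment> \<open>\<open>r\<close> is the middle vertex joining \<open>u\<close> and
      \<open>v\<close> if they are not adjacent, and arbitrary otherwise. The corresponding
      \<open>r'\<close> for \<open>x\<close> and \<open>y\<close> must also differ from
      \<open>r\<close> if both are used; the bounds five and six make room for them.\<close>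
    have "\<exists>r. \<not> E u v \<longrightarrow> r \<in> V \<and> r \<notin> {u, v, x, y}"
    proof (cases "E u v")
      case False
      then have "length [u, v, x, y] < card V" using h5[OF m(1,2) uv] by simp
      then obtain r where "r \<in> V" "r \<notin> set [u, v, x, y]" by (rule ex_avoiding)
      then show ?thesis by auto
    qed simp
    then obtain r where r: "\<not> E u v \<Longrightarrow> r \<in> V \<and> r \<notin> {u, v, x, y}" by blast
    have "\<exists>r'. \<not> E x y \<longrightarrow> r' \<in> V \<and> r' \<notin> {u, v, x, y} \<and> (\<not> E u v \<longrightarrow> r' \<noteq> r)"
    proof (cases "E x y")
      case nxy: False
      show ?thesis
      proof (cases "E u v")
        case True
        have "length [u, v, x, y] < card V" using h5[OF m(3,4) xy nxy] by simp
        then obtain r' where "r' \<in> V" "r' \<notin> set [u, v, x, y]" by (rule ex_avoiding)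
        then show ?thesis using True by auto
      next
        case False
        have "length [u, v, x, y, r] < card V" using h6[OF m d False nxy] by simp
        then obtain r' where "r' \<in> V" "r' \<notin> set [u, v, x, y, r]" by (rule ex_avoiding)
        then show ?thesis by auto
      qed
    qed simp
    then obtain r' where r': "\<not> E x y \<Longrightarrow> r' \<in> V \<and> r' \<notin> {u, v, x, y} \<and> (\<not> E u v \<longrightarrow> r' \<noteq> r)"
      by blast
    define seg where "seg a b c = (if E a b then {a, b} else {a, c, b})" for a b c
    have seg: "ham E (seg a b c) a b" if "a \<in> V" "b \<in> V" "a \<noteq> b" "\<not> E a b \<Longrightarrow> c \<in> V \<and> c \<notin> {a, b}" for a b c
    proof (cases "E a b")
      case True then show ?thesis using ham_edge that by (simp add: seg_def)
    next
      case False
      \<comment> \<open>The one non-neighbour allowed to \<open>a\<close> is already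
        \<open>b\<close>, and conversely, so \<open>c\<close> is adjacent to both.\<close>
      then have "E a c" "E c b"
        using that nn[of a b c] nn[of b a c] sympD[OF E] by (metis insertCI)+
      then have "ham E {a, c, b} a b" using that False by (intro ham_Cons[OF ham_edge]) auto
      then show ?thesis using False by (simp add: seg_def)
    qed
    have W0: "ham2 E (seg u v r \<union> seg x y r') u v x y"
      by (rule ham2I[OF seg seg]) (use m d r r' in \<open>auto simp: seg_def split: if_splits\<close>)
    have W0': "seg u v r \<union> seg x y r' \<subseteq> V"
      using m r r' by (auto simp: seg_def split: if_splits)
    have ins: "ham2 E (insert w W) u v x y" if W: "ham2 E W u v x y" "W \<subseteq> V" "w \<in> V" "w \<notin> W" for w W
    proof -
      obtain P Q where P: "ham E P u v" "ham E Q x y" "P \<inter> Q = {}" "W = P \<union> Q"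
        using W(1) by (rule ham2E)
      show ?thesis
      proof (cases "\<forall>a\<in>P. E w a")
        case True
        then have "ham E (insert w P) u v" by (intro ham_insert[OF P(1)]) (use d W P E in auto)
        then show ?thesis by (rule ham2I[OF _ P(2)]) (use P W in auto)
      next
        case False
        then obtain p where p: "p \<in> P" "\<not> E w p" by blast
        have "E w a" if "a \<in> Q" for a
          using nn[of w p a] p that P W by blast
        then have "ham E (insert w Q) x y" by (intro ham_insert[OF P(2)]) (use d W P E in auto)
        then show ?thesis by (rule ham2I[OF P(1)]) (use P W in auto)
      qed
    qed
    \<comment> \<open>\<open>D\<close> may overlap the two initial paths, so that it can finally be
      taken to be \<open>V\<close>.\<close>
    have "ham2 E (seg u v r \<union> seg x y r' \<union> D) u v x y"
      if "finite D" "D \<subseteq> V" for D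
      using that
    proof (induction D)
      case empty then show ?case using W0 by simp
    next
      case (insert w D)
      then show ?case
        using ins[of "seg u v r \<union> seg x y r' \<union> D" w] W0'
        by (cases "w \<in> seg u v r \<union> seg x y r' \<union> D") (auto simp: insert_absorb)
    qed
    from this[OF fin] show ?thesis using W0' by (simp add: Un_absorb1)
  qed
  show ?thesis
  proof (cases "card V \<ge> 4")
    case True
    then show ?thesis using h2 by (intro linkableI[OF fin E])
  next
    case False
    have "ham E V u v" if uv: "u \<in> V" "v \<in> V" "u \<noteq> v" for u v
    proof -
      \<comment> \<open>Below four vertices \<open>h5\<close> excludes non-adjacent pairs, so the
        graph is complete.\<close>
      have adj: "E a b" if "a \<in> V" "b \<in> V" "a \<noteq> b" for a b using h5[of a b] False that by linarith
      have "ham E ({u, v} \<union> D) u v" if "finite D" "D \<subseteq> V" for D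
        using that
      proof (induction D)
        case empty then show ?case using uv adj by (simp add: ham_edge)
      next
        case (insert w D)
        show ?case
        proof (cases "w \<in> {u, v}")
          case True
          then have "{u, v} \<union> insert w D = {u, v} \<union> D" by auto
          then show ?thesis using insert by simp
        next
          case False
          then have "ham E (insert w ({u, v} \<union> D)) u v"
            using insert uv E by (intro ham_insert) (auto intro!: adj)
          then show ?thesis by simp
        qed
      qed
      from this[OF fin] show ?thesis using uv by (simp add: insert_absorb)
    qed
    then show ?thesis unfolding linkable_def using h2 by blast
  qed
qed

section \<open>Exhaustive search on a small graph\<close>

lemma length_remove1_less [termination_simp]: "r \<in> set R \<Longrightarrow> length (remove1 r R) < length R"
  using length_pos_if_in_set[of r R] by (simp add: length_remove1)

text \<open>Backtracking: \<open>R\<close> lists the inner vertices still to be visited between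
  \<open>x\<close> and \<open>y\<close>, all of which must be used.\<close>

fun hsearch :: "('a \<Rightarrow> 'a \<Rightarrow> bool) \<Rightarrow> 'a \<Rightarrow> 'a \<Rightarrow> 'a list \<Rightarrow> bool" where
  "hsearch E x y R =
     (if R = [] then E x y else list_ex (\<lambda>r. E x r \<and> hsearch E r y (remove1 r R)) R)"

fun hsearch2 :: "('a \<Rightarrow> 'a \<Rightarrow> bool) \<Rightarrow> 'a \<Rightarrow> 'a \<Rightarrow> 'a \<Rightarrow> 'a \<Rightarrow> 'a list \<Rightarrow> bool" where
  "hsearch2 E u v x y R =
     (E u v \<and> hsearch E x y R \<or> list_ex (\<lambda>r. E u r \<and> hsearch2 E r v x y (remove1 r R)) R)"

declare hsearch.simps [simp del] hsearch2.simps [simp del]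

lemma hsearch_sound:
  "hsearch E x y R \<Longrightarrow> distinct (x # y # R) \<Longrightarrow> ham E (set (x # y # R)) x y"
proof (induction E x y R rule: hsearch.induct)
  case (1 E x y R)
  show ?case
  proof (cases "R = []")
    case True
    then show ?thesis using 1 by (auto simp: hsearch.simps intro: ham_edge)
  next
    case False
    then obtain r where r: "r \<in> set R" "E x r" "hsearch E r y (remove1 r R)"
      using "1.prems" by (subst (asm) hsearch.simps) (auto simp: list_ex_iff)
    have "ham E (set (r # y # remove1 r R)) r y"
      using 1 False r by (intro "1.IH") auto
    then have "ham E (insert x (set (r # y # remove1 r R))) x y"
      by (rule ham_Cons) (use r 1 in auto)
    moreover have "insert x (set (r # y # remove1 r R)) = set (x # y # R)"
      using r 1 by auto
    ultimately show ?thesis by simp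
  qed
qed

lemma hsearch2_sound:
  "hsearch2 E u v x y R \<Longrightarrow> distinct (u # v # x # y # R) \<Longrightarrow>
    ham2 E (set (u # v # x # y # R)) u v x y"
proof (induction E u v x y R rule: hsearch2.induct)
  case (1 E u v x y R)
  show ?case
  proof (cases "E u v \<and> hsearch E x y R")
    case True
    then have "ham E {u, v} u v" "ham E (set (x # y # R)) x y"
      using hsearch_sound[of E x y R] ham_edge[of E u v] 1 by auto
    then show ?thesis by (rule ham2I) (use 1 in auto)
  next
    case False
    then obtain r where r: "r \<in> set R" "E u r" "hsearch2 E r v x y (remove1 r R)"
      using "1.prems" by (subst (asm) hsearch2.simps) (auto simp: list_ex_iff)
    have "ham2 E (set (r # v # x # y # remove1 r R)) r v x y"
      using 1 r by (intro "1.IH") auto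
    then obtain W W' where W: "ham E W r v" "ham E W' x y" "W \<inter> W' = {}"
      "set (r # v # x # y # remove1 r R) = W \<union> W'"
      by (rule ham2E)
    have u: "u \<notin> W \<union> W'" unfolding W(4)[symmetric] using 1 r by auto
    have "ham E (insert u W) u v" by (rule ham_Cons[OF W(1)]) (use r u in auto)
    then show ?thesis
    proof (rule ham2I[OF _ W(2)])
      have "set (u # v # x # y # R) = insert u (set (r # v # x # y # remove1 r R))"
        using r 1 by auto
      also have "\<dots> = insert u W \<union> W'" unfolding W(4) by simp
      finally show "set (u # v # x # y # R) = insert u W \<union> W'" .
    qed (use W u in auto)
  qed
qed

fun pairs :: "'a list \<Rightarrow> ('a \<times> 'a) list" where
  "pairs [] = []"
| "pairs (a # xs) = map (Pair a) xs @ pairs xs"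

lemma pairs_total: "a \<in> set xs \<Longrightarrow> b \<in> set xs \<Longrightarrow> a \<noteq> b \<Longrightarrow> (a, b) \<in> set (pairs xs) \<or> (b, a) \<in> set (pairs xs)"
  by (induction xs) auto

text \<open>Each choice of endpoints is searched once up to reversing either path and exchanging the
  two, an eightfold saving.\<close>

definition all_linked :: "('a \<Rightarrow> 'a \<Rightarrow> bool) \<Rightarrow> 'a list \<Rightarrow> bool" where
  "all_linked E vs \<longleftrightarrow>
     list_all (\<lambda>((u, v), (x, y)). distinct [u, v, x, y] \<longrightarrow>
       hsearch2 E u v x y (filter (\<lambda>w. w \<notin> set [u, v, x, y]) vs)) (pairs (pairs vs))"

text \<open>The symmetries left out of the enumeration are restored one at a time: exchange of the
  paths in \<open>semi\<close>, reversal of the first in \<open>half\<close>, reversal of the second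
  at the end.\<close>

lemma linkable_all_linked:
  assumes "all_linked E vs" "distinct vs" "length vs \<ge> 4" "symp E"
  shows "linkable E (set vs)"
proof (rule linkableI)
  show "card (set vs) \<ge> 4" using assms distinct_card by fastforce
  have ordered: "ham2 E (set vs) u v x y"
    if d: "distinct [u, v, x, y]" and m: "set [u, v, x, y] \<subseteq> set vs"
      and p: "((u, v), (x, y)) \<in> set (pairs (pairs vs))" for u v x y
  proof -
    let ?R = "filter (\<lambda>w. w \<notin> set [u, v, x, y]) vs"
    have "hsearch2 E u v x y ?R"
      using assms(1) d p unfolding all_linked_def list_all_iff by blast
    then have "ham2 E (set (u # v # x # y # ?R)) u v x y"
      by (rule hsearch2_sound) (use d assms(2) in auto)
    moreover have "set (u # v # x # y # ?R) = set vs" using m by auto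
    ultimately show ?thesis by simp
  qed
  have semi: "ham2 E (set vs) u v x y"
    if d: "distinct [u, v, x, y]" and m: "set [u, v, x, y] \<subseteq> set vs"
      and p: "(u, v) \<in> set (pairs vs)" "(x, y) \<in> set (pairs vs)" for u v x y
  proof -
    have "((u, v), (x, y)) \<in> set (pairs (pairs vs)) \<or> ((x, y), (u, v)) \<in> set (pairs (pairs vs))"
      by (rule pairs_total) (use d p in auto)
    then show ?thesis
      using ordered[of u v x y] ordered[of x y u v] ham2_swap[of E "set vs" x y u v] d m by auto
  qed
  fix u v x y
  assume m: "u \<in> set vs" "v \<in> set vs" "x \<in> set vs" "y \<in> set vs" and d: "distinct [u, v, x, y]"
  have half: "ham2 E (set vs) u v c d"
    if "(c, d) \<in> set (pairs vs)" "distinct [u, v, c, d]" "set [c, d] \<subseteq> set vs" for c d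
  proof (cases "(u, v) \<in> set (pairs vs)")
    case True
    then show ?thesis using semi m that by simp
  next
    case False
    then have "(v, u) \<in> set (pairs vs)" using pairs_total[of u vs v] m that by auto
    then have "ham2 E (set vs) v u c d" using m that by (intro semi) auto
    then show ?thesis by (rule ham2_rev1[OF assms(4)])
  qed
  show "ham2 E (set vs) u v x y"
  proof (cases "(x, y) \<in> set (pairs vs)")
    case True
    then show ?thesis using half m d by simp
  next
    case False
    then have "(y, x) \<in> set (pairs vs)" using pairs_total[of x vs y] m d by auto
    then have "ham2 E (set vs) u v y x" using m d by (intro half) auto
    then show ?thesis by (rule ham2_rev2[OF assms(4)])
  qed
qed (use assms in auto)

section \<open>The family of layered graphs\<close>

definition layers :: "nat \<Rightarrow> nat set \<Rightarrow> nat set set" where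
  "layers n A = {S. S \<subseteq> {1..n} \<and> card S \<in> A}"

text \<open>Replaces the indices \<open>i\<close> and \<open>Suc i\<close> in the sorted list of
  \<open>A\<close>; unlike indices, it is easily followed through a shift or a reflection of the
  level set.\<close>

definition consec :: "nat set \<Rightarrow> nat \<Rightarrow> nat \<Rightarrow> bool" where
  "consec A k l \<longleftrightarrow> k \<in> A \<and> l \<in> A \<and> k < l \<and> (\<forall>j\<in>A. \<not> (k < j \<and> j < l))"

text \<open>The successor form excludes \<open>S = T\<close> by itself and avoids truncated
  subtraction at level 0.\<close>

definition ladj :: "nat set \<Rightarrow> nat set \<Rightarrow> nat set \<Rightarrow> bool" where
  "ladj A S T \<longleftrightarrow> card S = card T \<and> Suc (card (S \<inter> T)) = card S
     \<or> S \<subset> T \<and> consec A (card S) (card T) \<or> T \<subset> S \<and> consec A (card T) (card S)"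

lemma symp_ladj: "symp (ladj A)"
  by (rule sympI) (auto simp: ladj_def Int_commute)

lemma finite_layers: "finite (layers n A)"
  by (rule finite_subset[of _ "Pow {1..n}"]) (auto simp: layers_def)

section \<open>The case \<open>n = 3\<close> with levels 1 and 2 present\<close>

text \<open>The vertex \<open>Ci\<close> stands for the subset of \<open>{1, 2, 3}\<close> with binary code \<open>i\<close>.\<close>
datatype cube = C0 | C1 | C2 | C3 | C4 | C5 | C6 | C7

fun cube_set :: "cube \<Rightarrow> nat set" where
  "cube_set C0 = {}" | "cube_set C1 = {1}" | "cube_set C2 = {2}" | "cube_set C3 = {1, 2}"
| "cube_set C4 = {3}" | "cube_set C5 = {1, 3}" | "cube_set C6 = {2, 3}" | "cube_set C7 = {1, 2, 3}"

text \<open>The neighbours for the level set \<open>{0, 1, 2, 3}\<close>, listed explicitly to make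
  adjacency executable.\<close>

fun cube_nbrs :: "cube \<Rightarrow> cube list" where
  "cube_nbrs C0 = [C1, C2, C4]" | "cube_nbrs C1 = [C0, C2, C3, C4, C5]"
| "cube_nbrs C2 = [C0, C1, C3, C4, C6]" | "cube_nbrs C3 = [C1, C2, C5, C6, C7]"
| "cube_nbrs C4 = [C0, C1, C2, C5, C6]" | "cube_nbrs C5 = [C1, C3, C4, C6, C7]"
| "cube_nbrs C6 = [C2, C3, C4, C5, C7]" | "cube_nbrs C7 = [C3, C5, C6]"

definition cube_adj :: "cube \<Rightarrow> cube \<Rightarrow> bool" where
  "cube_adj i j \<longleftrightarrow> j \<in> set (cube_nbrs i)"

lemma symp_cube_adj: "symp cube_adj"
proof (rule sympI)
  fix i j show "cube_adj i j \<Longrightarrow> cube_adj j i"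
    by (cases i; cases j) (simp_all add: cube_adj_def)
qed

lemma inj_cube_set: "inj cube_set"
proof (rule injI)
  fix i j assume "cube_set i = cube_set j"
  then have "1 \<in> cube_set i \<longleftrightarrow> 1 \<in> cube_set j" "2 \<in> cube_set i \<longleftrightarrow> 2 \<in> cube_set j"
    "3 \<in> cube_set i \<longleftrightarrow> 3 \<in> cube_set j" by simp_all
  then show "i = j" by (cases i; cases j) simp_all
qed

lemma cube_adj_cases:
  "cube_adj i j \<Longrightarrow>
    card (cube_set i) = card (cube_set j) \<and> Suc (card (cube_set i \<inter> cube_set j)) = card (cube_set i)
    \<or> cube_set i \<subseteq> cube_set j \<and> card (cube_set j) = Suc (card (cube_set i))
    \<or> cube_set j \<subseteq> cube_set i \<and> card (cube_set i) = Suc (card (cube_set j))"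
  by (cases i; cases j) (simp_all add: cube_adj_def)

text \<open>The four lists record which of the levels 0 and 3 are present.\<close>

lemma all_linked_cube:
  "all_linked cube_adj [C1, C2, C3, C4, C5, C6]"
  "all_linked cube_adj [C0, C1, C2, C3, C4, C5, C6]"
  "all_linked cube_adj [C1, C2, C3, C4, C5, C6, C7]"
  "all_linked cube_adj [C0, C1, C2, C3, C4, C5, C6, C7]"
  by code_simp+

text \<open>Only levels 0 and 3 can be missing, so levels differing by one are consecutive, and
  every cube edge between remaining vertices is an edge here.\<close>

lemma linkable_layers_3_middle:
  assumes "1 \<in> A" "2 \<in> A"
  shows "linkable (ladj A) (layers 3 A)"
proof -
  define vs where "vs = (if 0 \<in> A then [C0] else []) @ [C1, C2, C3, C4, C5, C6] @
    (if 3 \<in> A then [C7] else [])"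
  have "linkable cube_adj (set vs)"
    by (rule linkable_all_linked[OF _ _ _ symp_cube_adj])
      (auto simp: vs_def all_linked_cube)
  moreover have "inj_on cube_set (set vs)" using inj_cube_set by (rule inj_on_subset) simp
  moreover have "ladj A (cube_set i) (cube_set j)"
    if "i \<in> set vs" "j \<in> set vs" "cube_adj i j" for i j
  proof -
    have vs: "i \<in> set vs \<Longrightarrow> card (cube_set i) \<in> A" for i
      using assms by (cases i) (simp_all add: vs_def numeral_2_eq_2 numeral_3_eq_3 split: if_splits)
    have c: "consec A k (Suc k)" if "k \<in> A" "Suc k \<in> A" for k
      using that by (auto simp: consec_def)
    from cube_adj_cases[OF that(3)] consider
      "card (cube_set i) = card (cube_set j)" "Suc (card (cube_set i \<inter> cube_set j)) = card (cube_set i)"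
      | "cube_set i \<subseteq> cube_set j" "card (cube_set j) = Suc (card (cube_set i))"
      | "cube_set j \<subseteq> cube_set i" "card (cube_set i) = Suc (card (cube_set j))"
      by blast
    then show ?thesis
    proof cases
      case 1
      then show ?thesis unfolding ladj_def by blast
    next
      case 2
      then have "consec A (card (cube_set i)) (card (cube_set j))" "cube_set i \<noteq> cube_set j"
        using c vs[OF that(1)] vs[OF that(2)] by auto
      then show ?thesis unfolding ladj_def using 2 by blast
    next
      case 3
      then have "consec A (card (cube_set j)) (card (cube_set i))" "cube_set i \<noteq> cube_set j"
        using c vs[OF that(1)] vs[OF that(2)] by auto
      then show ?thesis unfolding ladj_def using 3 by blast
    qed
  qed
  ultimately have "linkable (ladj A) (cube_set ` set vs)" by (rule linkable_image)
  moreover have "cube_set ` set vs = layers 3 A"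
  proof -
    have "{1..3::nat} = {1, 2, 3}" by auto
    then have "layers 3 A = {S \<in> Pow {1, 2, 3}. card S \<in> A}" by (simp add: layers_def)
    also have "Pow {1, 2, 3::nat} = cube_set ` UNIV"
    proof -
      have UNIV: "UNIV = {C0, C1, C2, C3, C4, C5, C6, C7}" using cube.exhaust by blast
      show ?thesis unfolding UNIV by (simp add: Pow_insert insert_commute Un_commute)
    qed
    also have "{S \<in> cube_set ` UNIV. card S \<in> A} = cube_set ` {i. card (cube_set i) \<in> A}" by blast
    also have "{i. card (cube_set i) \<in> A} = set vs"
    proof (rule set_eqI)
      fix i show "i \<in> {i. card (cube_set i) \<in> A} \<longleftrightarrow> i \<in> set vs"
        using assms by (cases i) (simp_all add: vs_def numeral_2_eq_2 numeral_3_eq_3)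
    qed
    finally show ?thesis by simp
  qed
  ultimately show ?thesis by simp
qed

section \<open>Basic facts on layers, and complementation\<close>

lemma layersD:
  assumes "S \<in> layers n A"
  shows "S \<subseteq> {1..n}" "finite S" "card S \<in> A" "card S \<le> n"
  using assms finite_subset[of S "{1..n}"] card_mono[of "{1..n}" S] by (auto simp: layers_def)

lemma card_0_layer: "S \<in> layers n A \<Longrightarrow> card S = 0 \<Longrightarrow> S = {}"
  using layersD(2) by auto

lemma card_top_layer: "S \<in> layers n A \<Longrightarrow> card S = n \<Longrightarrow> S = {1..n}"
  using layersD(1) by (intro card_subset_eq) auto

lemma card_layer: "card {S. S \<subseteq> {1..n} \<and> card S = k} = n choose k"
  using n_subsets[of "{1..n}" k] by simp

lemma consec_exists:
  assumes "k \<in> A" "l \<in> A" "k < l"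
  obtains j where "consec A k j" "j \<le> l"
proof -
  let ?P = "\<lambda>j. j \<in> A \<and> k < j"
  have "?P (LEAST j. ?P j)" by (rule LeastI[of ?P l]) (use assms in simp)
  moreover have "(LEAST j. ?P j) \<le> l" by (rule Least_le) (use assms in simp)
  moreover have "\<not> j < (LEAST j. ?P j)" if "?P j" for j using not_less_Least that by blast
  ultimately show thesis using that[of "LEAST j. ?P j"] assms by (auto simp: consec_def)
qed

lemma ladj_consec: "S \<subseteq> T \<Longrightarrow> consec A (card S) (card T) \<Longrightarrow> ladj A S T"
  by (auto simp: ladj_def consec_def)

lemma ladj_card_le:
  assumes "ladj A S T" "card S < card T"
  shows "consec A (card S) (card T)"
  using assms by (auto simp: ladj_def consec_def)

lemma ladj_exchange:
  assumes "finite S" "a \<in> S" "b \<notin> S"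
  shows "ladj A S (insert b (S - {a}))" "card (insert b (S - {a})) = card S"
proof -
  have "S \<inter> insert b (S - {a}) = S - {a}" using assms by auto
  moreover have "Suc (card (S - {a})) = card S" using assms card_Suc_Diff1 by metis
  ultimately show "ladj A S (insert b (S - {a}))" "card (insert b (S - {a})) = card S"
    using assms by (auto simp: ladj_def)
qed

text \<open>Complementation reverses inclusions and reflects the levels. Adjacent sets of one level
  have a union with one element more, so their complements again share all but one element.\<close>

lemma ladj_compl:
  assumes "S \<subseteq> {1..n}" "T \<subseteq> {1..n}" "ladj A S T" and AB: "\<And>k. k \<le> n \<Longrightarrow> k \<in> B \<longleftrightarrow> n - k \<in> A"
  shows "ladj B ({1..n} - S) ({1..n} - T)"
proof -
  have fin: "finite S" "finite T" by (rule finite_subset[OF assms(1)], simp, rule finite_subset[OF assms(2)], simp)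
  have c: "card ({1..n} - S) = n - card S" "card ({1..n} - T) = n - card T"
    using assms fin by (simp_all add: card_Diff_subset)
  have le: "card S \<le> n" "card T \<le> n" using assms card_mono[of "{1..n}"] by fastforce+
  have cc: "consec B (n - l) (n - k)" if kl: "consec A k l" "l \<le> n" for k l
    unfolding consec_def
  proof (intro conjI ballI)
    show "n - l \<in> B" "n - k \<in> B" "n - l < n - k" using that AB by (auto simp: consec_def)
    fix j assume "j \<in> B"
    show "\<not> (n - l < j \<and> j < n - k)"
    proof
      assume j: "n - l < j \<and> j < n - k"
      then have "n - j \<in> A" "k < n - j" "n - j < l" using AB[of j] \<open>j \<in> B\<close> kl(2) by auto
      then show False using kl(1) by (auto simp: consec_def)
    qed
  qed
  consider "card S = card T" "Suc (card (S \<inter> T)) = card S" | "S \<subset> T" "consec A (card S) (card T)"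
    | "T \<subset> S" "consec A (card T) (card S)" using assms(3) unfolding ladj_def by blast
  then show ?thesis
  proof cases
    case 1
    have "card (S \<union> T) = Suc (card S)" using card_Un_Int[OF fin] 1 by simp
    moreover have "card (S \<union> T) \<le> n" using assms(1,2) card_mono[of "{1..n}" "S \<union> T"] by simp
    moreover have "card ({1..n} - (S \<union> T)) = n - card (S \<union> T)"
      using assms(1,2) fin by (subst card_Diff_subset) auto
    moreover have "({1..n} - S) \<inter> ({1..n} - T) = {1..n} - (S \<union> T)" by auto
    ultimately show ?thesis using 1 c by (simp add: ladj_def Suc_diff_Suc)
  next
    case 2
    have "consec B (card ({1..n} - T)) (card ({1..n} - S))" unfolding c by (rule cc[OF 2(2) le(2)])
    then have "ladj B ({1..n} - T) ({1..n} - S)" using 2(1) by (intro ladj_consec) auto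
    then show ?thesis by (rule sympD[OF symp_ladj])
  next
    case 3
    have "consec B (card ({1..n} - S)) (card ({1..n} - T))" unfolding c by (rule cc[OF 3(2) le(1)])
    then show ?thesis using 3(1) by (intro ladj_consec) auto
  qed
qed

lemma compl_layer:
  assumes "S \<in> layers n A" "\<And>k. k \<le> n \<Longrightarrow> k \<in> B \<longleftrightarrow> n - k \<in> A"
  shows "{1..n} - S \<in> layers n B"
  using layersD[OF assms(1)] assms(2) by (auto simp: layers_def card_Diff_subset)

text \<open>Lets the case distinctions below treat only one of two mirror-image level sets.\<close>

lemma linkable_layers_compl:
  assumes "linkable (ladj B) (layers n B)" and AB: "\<And>k. k \<le> n \<Longrightarrow> k \<in> B \<longleftrightarrow> n - k \<in> A"
  shows "linkable (ladj A) (layers n A)"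
proof -
  have BA: "k \<in> A \<longleftrightarrow> n - k \<in> B" if "k \<le> n" for k using AB[of "n - k"] that by simp
  let ?f = "\<lambda>S. {1..n} - S"
  have "inj_on ?f (layers n B)" by (rule inj_onI) (use layersD(1) in blast)
  moreover have "ladj A (?f S) (?f T)" if "S \<in> layers n B" "T \<in> layers n B" "ladj B S T" for S T
    using ladj_compl[OF layersD(1)[OF that(1)] layersD(1)[OF that(2)] that(3)] BA by blast
  ultimately have "linkable (ladj A) (?f ` layers n B)" by (rule linkable_image[OF assms(1)])
  moreover have "?f ` layers n B = layers n A"
  proof (intro equalityI subsetI)
    fix S assume S: "S \<in> layers n A"
    then have "?f S \<in> layers n B" using compl_layer AB by blast
    moreover have "S = ?f (?f S)" using layersD(1)[OF S] by auto
    ultimately show "S \<in> ?f ` layers n B" by blast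
  qed (use compl_layer BA in blast)
  ultimately show ?thesis by simp
qed

section \<open>Level sets that give nearly complete graphs\<close>

text \<open>Levels 1 and \<open>n - 1\<close> are complete graphs, and the empty and the full set
  are comparable with everything. As 1 and \<open>n - 1\<close> do not both occur, the only pair
  that can fail to be adjacent is the empty and the full set, separated by an intermediate
  level.\<close>

lemma linkable_layers_extreme:
  assumes n: "n \<ge> 3" and A: "\<And>k. k \<in> A \<Longrightarrow> k \<le> n \<Longrightarrow> k \<in> {0, 1, n - 1, n}"
    and not_both: "1 \<notin> A \<or> n - 1 \<notin> A"
  shows "linkable (ladj A) (layers n A)"
proof -
  let ?V = "layers n A"
  have card: "card S \<in> {0, 1, n - 1, n}" if "S \<in> ?V" for S using A layersD[OF that] by blast
  have lt_case: "ladj A S T \<or> S = {} \<and> T = {1..n} \<and> (\<exists>k\<in>{1, n - 1}. k \<in> A)"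
    if S: "S \<in> ?V" and T: "T \<in> ?V" and lt: "card S < card T" for S T
  proof (cases "card S = 0 \<and> card T = n")
    case True
    show ?thesis
    proof (cases "\<exists>k\<in>{1, n - 1}. k \<in> A")
      case False
      have "j \<notin> A" if "0 < j" "j < n" for j using A[of j] False that by auto
      then have "consec A (card S) (card T)"
        using layersD(3)[OF S] layersD(3)[OF T] True n by (auto simp: consec_def)
      then show ?thesis using True card_0_layer[OF S] by (auto intro: ladj_consec)
    qed (use True card_0_layer[OF S] card_top_layer[OF T] in blast)
  next
    case False
    have "consec A (card S) (card T)"
      unfolding consec_def
    proof (intro conjI ballI)
      fix j assume j: "j \<in> A"
      show "\<not> (card S < j \<and> j < card T)"
      proof
        assume jj: "card S < j \<and> j < card T"
        then have "j \<le> n" using layersD(4)[OF T] by simp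
        then have "j \<in> {0, 1, n - 1, n}" by (rule A[OF j])
        then show False
          using jj j False not_both n card[OF S] card[OF T] layersD(3)[OF S] layersD(3)[OF T] by auto
      qed
    qed (use lt layersD[OF S] layersD[OF T] in auto)
    moreover have "card S = 0 \<or> card T = n"
      using card[OF S] card[OF T] lt not_both n layersD(3)[OF S] layersD(3)[OF T] by auto
    then have "S \<subseteq> T" using card_0_layer[OF S] card_top_layer[OF T] layersD(1)[OF S] by auto
    ultimately show ?thesis by (auto intro: ladj_consec)
  qed
  have eq: "ladj A S T" if S: "S \<in> ?V" and T: "T \<in> ?V" and e: "card S = card T" "S \<noteq> T" for S T
  proof -
    have "card S = 1 \<or> card S = n - 1"
      using card[OF S] e card_0_layer[OF S] card_0_layer[OF T] card_top_layer[OF S] card_top_layer[OF T]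
      by auto
    then show ?thesis
    proof
      assume "card S = 1"
      then obtain s t where "S = {s}" "T = {t}" using e by (metis card_1_singletonE)
      then show ?thesis using e by (simp add: ladj_def)
    next
      assume c: "card S = n - 1"
      \<comment> \<open>Two different sets of size \<open>n - 1\<close> have a union of size
        \<open>n\<close>, hence meet in \<open>n - 2\<close> elements.\<close>
      have "\<not> T \<subseteq> S" using e card_subset_eq[OF layersD(2)[OF S]] by metis
      then have "card S < card (S \<union> T)"
        using layersD(2)[OF S] layersD(2)[OF T] by (intro psubset_card_mono) auto
      moreover have "card (S \<union> T) \<le> n"
        using layersD(1)[OF S] layersD(1)[OF T] card_mono[of "{1..n}" "S \<union> T"] by simp
      moreover have "card S + card T = card (S \<union> T) + card (S \<inter> T)"
        by (rule card_Un_Int) (use layersD[OF S] layersD[OF T] in auto)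
      ultimately show ?thesis using c e n by (auto simp: ladj_def)
    qed
  qed
  have non: "{S, T} = {{}, {1..n}} \<and> (\<exists>k\<in>{1, n - 1}. k \<in> A)"
    if "S \<in> ?V" "T \<in> ?V" "S \<noteq> T" "\<not> ladj A S T" for S T
  proof (cases "card S" "card T" rule: linorder_cases)
    case less
    then show ?thesis using lt_case[of S T] that by auto
  next
    case greater
    then show ?thesis using lt_case[of T S] that sympD[OF symp_ladj, of A T S] by auto
  qed (use eq that in blast)
  show ?thesis
  proof (rule linkable_near_complete[OF finite_layers symp_ladj])
    fix w a b assume "w \<in> ?V" "a \<in> ?V" "b \<in> ?V" "a \<noteq> w" "b \<noteq> w" "\<not> ladj A w a" "\<not> ladj A w b"
    then have "{w, a} = {w, b}" using non[of w a] non[of w b] by metis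
    then show "a = b" by (auto simp: doubleton_eq_iff)
  next
    fix u v x y assume m: "u \<in> ?V" "v \<in> ?V" "x \<in> ?V" "y \<in> ?V"
      and d: "distinct [u, v, x, y]" "\<not> ladj A u v" "\<not> ladj A x y"
    \<comment> \<open>Both pairs would be the empty and the full set, against distinctness; the
      bound holds vacuously.\<close>
    then have "{u, v} = {x, y}" using non[of u v] non[of x y] by simp
    then show "card ?V \<ge> 6" using d by (auto simp: doubleton_eq_iff)
  next
    fix u v assume uv: "u \<in> ?V" "v \<in> ?V" "u \<noteq> v" "\<not> ladj A u v"
    then obtain k where k: "k \<in> {1, n - 1}" "k \<in> A" using non by blast
    have e: "{} \<in> ?V" "{1..n} \<in> ?V" using non[OF uv] uv by (auto simp: doubleton_eq_iff)
    \<comment> \<open>The separating level has \<open>n\<close> sets; with the two non-adjacent ones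
      this makes at least five vertices.\<close>
    let ?L = "{S. S \<subseteq> {1..n} \<and> card S = k}"
    have "n choose k = n" using k n binomial_symmetric[of 1 n] by auto
    then have "card ?L = n" using card_layer by simp
    moreover have "finite ?L" using finite_layers[of n "{k}"] by (simp add: layers_def)
    moreover have "{} \<notin> ?L" "{1..n} \<notin> ?L" "{} \<noteq> {1..n}" using k n by auto
    ultimately have "card (insert {} (insert {1..n} ?L)) = n + 2" by simp
    moreover have "card (insert {} (insert {1..n} ?L)) \<le> card ?V"
      by (rule card_mono[OF finite_layers]) (use e k in \<open>auto simp: layers_def\<close>)
    ultimately show "card ?V \<ge> 5" using n by linarith
  qed
qed

text \<open>Level 2 is the octahedron, where only complementary sets are non-adjacent. The empty and
  the full set, if present, are adjacent to all of level 2 and complementary to each other. The six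
  sets of level 2 give the required vertex bounds.\<close>

lemma linkable_layers_4_even:
  assumes "2 \<in> A" "1 \<notin> A" "3 \<notin> A"
  shows "linkable (ladj A) (layers 4 A)"
proof -
  let ?V = "layers 4 A"
  have card: "card S \<in> {0, 2, 4}" if "S \<in> ?V" for S
  proof -
    have "card S \<le> 4" "card S \<noteq> 1" "card S \<noteq> 3" using layersD[OF that] assms by metis+
    then show ?thesis by auto
  qed
  have le: "ladj A S T \<or> T = {1..4} - S"
    if S: "S \<in> ?V" and T: "T \<in> ?V" and lt: "card S \<le> card T" "S \<noteq> T" for S T
  proof -
    have c: "consec A 0 2" if "0 \<in> A" using that assms
      by (auto simp: consec_def) (metis One_nat_def less_2_cases not_less_zero)
    have c': "consec A 2 4" if "4 \<in> A"
    proof -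
      have "\<not> (2 < j \<and> j < 4)" if "j \<in> A" for j
      proof
        assume "2 < j \<and> j < 4"
        then have "j = 3" by auto
        then show False using assms that by simp
      qed
      then show ?thesis using assms \<open>4 \<in> A\<close> by (simp add: consec_def)
    qed
    consider "card S = 0" "card T = 2" | "card S = 0" "card T = 4" | "card S = 2" "card T = 2"
      | "card S = 2" "card T = 4"
      using card[OF S] card[OF T] lt card_0_layer[OF S] card_0_layer[OF T] card_top_layer[OF S]
        card_top_layer[OF T] by auto
    then show ?thesis
    proof cases
      case 1
      then show ?thesis using card_0_layer[OF S] c layersD(3)[OF S] by (auto intro: ladj_consec)
    next
      case 2
      then show ?thesis using card_0_layer[OF S] card_top_layer[OF T] by auto
    next
      case 3
      have "card (S \<inter> T) \<noteq> 2"
      proof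
        assume i: "card (S \<inter> T) = 2"
        have "S \<inter> T = S" "S \<inter> T = T"
          by (rule card_subset_eq; use i 3 layersD[OF S] layersD[OF T] in auto)+
        then show False using lt by simp
      qed
      moreover have "card (S \<inter> T) \<le> 2" using 3 card_mono[of S "S \<inter> T"] layersD[OF S] by simp
      ultimately consider "card (S \<inter> T) = 1" | "card (S \<inter> T) = 0" by linarith
      then show ?thesis
      proof cases
        case 1
        then show ?thesis using 3 by (simp add: ladj_def)
      next
        case 2
        then have "S \<inter> T = {}" using layersD[OF S] by simp
        then have "T \<subseteq> {1..4} - S" using layersD(1)[OF T] by auto
        moreover have "card ({1..4} - S) = 2" using 3 layersD[OF S] by (simp add: card_Diff_subset)
        ultimately show ?thesis using 3 card_subset_eq[of "{1..4} - S" T] by simp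
      qed
    next
      case 4
      then show ?thesis
        using card_top_layer[OF T] layersD(1)[OF S] c' layersD(3)[OF T] by (auto intro: ladj_consec)
    qed
  qed
  have non: "T = {1..4} - S" if "S \<in> ?V" "T \<in> ?V" "S \<noteq> T" "\<not> ladj A S T" for S T
  proof (cases "card S \<le> card T")
    case False
    then have "S = {1..4} - T" using le[of T S] that sympD[OF symp_ladj, of A T S] by auto
    then show ?thesis using layersD(1)[OF that(2)] by auto
  qed (use le that in blast)
  let ?L = "{S. S \<subseteq> {1..4::nat} \<and> card S = 2}"
  have "card ?L = 6" using card_layer[of 4 2] by (simp add: numeral_eq_Suc)
  moreover have "?L \<subseteq> ?V" using assms by (auto simp: layers_def)
  ultimately have c6: "card ?V \<ge> 6" using card_mono[OF finite_layers, of ?L 4 A] by simp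
  show ?thesis
  proof (rule linkable_near_complete[OF finite_layers symp_ladj])
    fix w a b assume "w \<in> ?V" "a \<in> ?V" "b \<in> ?V" "a \<noteq> w" "b \<noteq> w" "\<not> ladj A w a" "\<not> ladj A w b"
    then show "a = b" using non[of w a] non[of w b] by simp
  qed (use c6 in auto)
qed

section \<open>Splitting off the largest element\<close>

lemma layers_exchange_up:
  assumes "S \<in> layers n A" "n \<notin> S" "s \<in> S"
  shows "insert n (S - {s}) \<in> {S \<in> layers n A. n \<in> S} \<and> ladj A S (insert n (S - {s}))"
proof -
  have "1 \<le> s" "s \<le> n" using layersD(1)[OF assms(1)] assms(3) by auto
  then have "insert n (S - {s}) \<subseteq> {1..n}" using layersD(1)[OF assms(1)] by auto
  then show ?thesis
    using ladj_exchange[OF layersD(2)[OF assms(1)] assms(3,2)] layersD(3)[OF assms(1)]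
    by (simp add: layers_def)
qed

text \<open>Serves the cases where exchanging an element for \<open>n\<close> does not suffice: the
  empty set, and singletons, whose only exchange is \<open>{n}\<close>.\<close>

lemma layers_superset_up:
  assumes "S \<in> layers n A" "n \<notin> S" "consec A (card S) j" "j \<le> n"
  obtains S' where "S' \<in> {S \<in> layers n A. n \<in> S}" "ladj A S S'" "card S' = j"
proof -
  have n: "n \<ge> 1" using assms(3,4) by (auto simp: consec_def)
  have "card (insert n S) \<le> j" using assms(2,3) layersD(2)[OF assms(1)] by (simp add: consec_def)
  then obtain S' where S': "insert n S \<subseteq> S'" "S' \<subseteq> {1..n}" "card S' = j"
    using exists_subset_between[of "insert n S" j "{1..n}"] layersD(1)[OF assms(1)] n assms(4) by auto
  moreover have "ladj A S S'" using S' assms(3) by (intro ladj_consec) auto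
  ultimately show thesis using that[of S'] assms(3) by (auto simp: layers_def consec_def)
qed

text \<open>If the larger set has at least two elements, its exchanges with \<open>n\<close> give
  two candidates, one of which differs from the neighbour chosen for the other set. If it is a
  singleton, it moves up to the next level, which exists because of \<open>l\<close>, while the
  other set moves to \<open>{n}\<close>.\<close>

lemma layers_lift_up:
  assumes S: "S \<in> layers n A" "n \<notin> S" and T: "T \<in> layers n A" "n \<notin> T"
    and ST: "S \<noteq> T" "ladj A S T" and l: "l \<in> A" "2 \<le> l" "l \<le> n"
  shows "\<exists>S'\<in>{S \<in> layers n A. n \<in> S}. \<exists>T'\<in>{S \<in> layers n A. n \<in> S}.
    S' \<noteq> T' \<and> ladj A S S' \<and> ladj A T T'"
proof -
  let ?U = "{S \<in> layers n A. n \<in> S}"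
  have ordered: "\<exists>S'\<in>?U. \<exists>T'\<in>?U. S' \<noteq> T' \<and> ladj A S S' \<and> ladj A T T'"
    if S: "S \<in> layers n A" "n \<notin> S" and T: "T \<in> layers n A" "n \<notin> T"
      and ST: "S \<noteq> T" "ladj A S T" and le: "card S \<le> card T" for S T
  proof -
    \<comment> \<open>If the empty set is adjacent to \<open>T\<close>, the level of
      \<open>T\<close> is the next one and offers a set containing \<open>n\<close>.\<close>
    have c0: "consec A 0 (card T)" if "S = {}"
    proof -
      have "card T \<noteq> 0" using card_0_layer[OF T(1)] ST that by auto
      then show ?thesis using ladj_card_le[OF ST(2)] that by simp
    qed
    show ?thesis
    proof (cases "card T \<ge> 2")
      case True
      have "\<exists>S'\<in>?U. ladj A S S'"
      proof (cases "S = {}")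
        case True
        then show ?thesis
          using layers_superset_up[OF S, of "card T"] c0 layersD(4)[OF T(1)] by auto
      next
        case False
        then show ?thesis using layers_exchange_up[OF S] by blast
      qed
      then obtain S' where S': "S' \<in> ?U" "ladj A S S'" by blast
      obtain t where t: "t \<in> T" "t \<notin> set []" using ex_avoiding[of "[]" T] True by auto
      obtain t' where t': "t' \<in> T" "t' \<notin> set [t]" using ex_avoiding[of "[t]" T] True by auto
      have "insert n (T - {t}) \<noteq> insert n (T - {t'})" using t t' T(2) by auto
      then obtain r where r: "r \<in> T" "S' \<noteq> insert n (T - {r})" using t(1) t'(1) by metis
      show ?thesis
      proof (intro bexI conjI)
        show "S' \<noteq> insert n (T - {r})" by (rule r(2))
        show "ladj A T (insert n (T - {r}))" "insert n (T - {r}) \<in> ?U"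
          using layers_exchange_up[OF T r(1)] by (rule conjunct2, rule conjunct1)
      qed (fact S')+
    next
      case False
      then have T1: "card T = 1"
        using le card_0_layer[OF S(1)] card_0_layer[OF T(1)] ST by (cases "card T = 0") auto
      then obtain j where j: "consec A (card T) j" "j \<le> l"
        using consec_exists[of "card T" A l] layersD(3)[OF T(1)] l by auto
      then obtain T' where T': "T' \<in> ?U" "ladj A T T'" "card T' = j"
        using layers_superset_up[OF T j(1)] l by auto
      have "\<exists>S'\<in>?U. ladj A S S' \<and> card S' = 1"
      proof (cases "S = {}")
        case True
        then show ?thesis
          using layers_superset_up[OF S, of 1] c0 T1 l by auto
      next
        case False
        then obtain s where s: "s \<in> S" by blast
        then have "card S \<noteq> 0" using layersD(2)[OF S(1)] by auto
        then have "card S = 1" using le T1 by simp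
        then have "card (insert n (S - {s})) = 1"
          using ladj_exchange(2)[OF layersD(2)[OF S(1)] s S(2)] by simp
        then show ?thesis using layers_exchange_up[OF S s] by blast
      qed
      then obtain S' where S': "S' \<in> ?U" "ladj A S S'" "card S' = 1" by blast
      have "card T' \<noteq> 1" using T' j T1 by (auto simp: consec_def)
      then have "S' \<noteq> T'" using S'(3) by auto
      then show ?thesis using S' T' by blast
    qed
  qed
  show ?thesis
  proof (cases "card S \<le> card T")
    case True
    then show ?thesis using ordered[OF S T ST] by blast
  next
    case False
    have "ladj A T S" using sympD[OF symp_ladj ST(2)] .
    then obtain T' S' where "T' \<in> ?U" "S' \<in> ?U" "T' \<noteq> S'" "ladj A T T'" "ladj A S S'"
      using ordered[OF T S] ST False by auto
    then show ?thesis by blast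
  qed
qed

text \<open>The mirror image of \<open>layers_lift_up\<close>: complementation interchanges the sets
  with and without \<open>n\<close> and turns \<open>l\<close> into \<open>n - l\<close>, which is
  at least 2.\<close>

lemma layers_lift_down:
  assumes S: "S \<in> layers n A" "n \<in> S" and T: "T \<in> layers n A" "n \<in> T"
    and ST: "S \<noteq> T" "ladj A S T" and l: "l \<in> A" "l + 2 \<le> n"
  shows "\<exists>S'\<in>{S \<in> layers n A. n \<notin> S}. \<exists>T'\<in>{S \<in> layers n A. n \<notin> S}.
    S' \<noteq> T' \<and> ladj A S S' \<and> ladj A T T'"
proof -
  define B where "B = {k. k \<le> n \<and> n - k \<in> A}"
  have B: "k \<in> B \<longleftrightarrow> n - k \<in> A" "k \<in> A \<longleftrightarrow> n - k \<in> B" if "k \<le> n" for k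
    using that by (auto simp: B_def)
  let ?f = "\<lambda>S. {1..n} - S"
  have ff: "?f (?f R) = R" if "R \<in> layers n C" for R C using layersD(1)[OF that] by auto
  have "\<exists>S'\<in>{S \<in> layers n B. n \<in> S}. \<exists>T'\<in>{S \<in> layers n B. n \<in> S}.
    S' \<noteq> T' \<and> ladj B (?f S) S' \<and> ladj B (?f T) T'"
  proof (rule layers_lift_up)
    show "?f S \<in> layers n B" "?f T \<in> layers n B" using S T compl_layer B(1) by blast+
    show "?f S \<noteq> ?f T" using ff[OF S(1)] ff[OF T(1)] ST(1) by metis
    show "ladj B (?f S) (?f T)"
      by (rule ladj_compl[OF layersD(1)[OF S(1)] layersD(1)[OF T(1)] ST(2)]) (use B in auto)
    show "n - l \<in> B" using l B(2)[of l] by simp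
  qed (use S T l in auto)
  then obtain S' T' where S': "S' \<in> layers n B" "n \<in> S'" "ladj B (?f S) S'"
    and T': "T' \<in> layers n B" "n \<in> T'" "ladj B (?f T) T'" and ne: "S' \<noteq> T'" by blast
  have from_compl: "ladj A R (?f R')" if "R \<in> layers n A" "R' \<in> layers n B" "ladj B (?f R) R'" for R R'
  proof -
    have "ladj A (?f (?f R)) (?f R')"
      by (rule ladj_compl[OF _ layersD(1)[OF that(2)] that(3)]) (use B in auto)
    then show ?thesis unfolding ff[OF that(1)] .
  qed
  show ?thesis
  proof (intro bexI conjI)
    show "?f S' \<noteq> ?f T'" using ff[OF S'(1)] ff[OF T'(1)] ne by metis
    show "ladj A S (?f S')" by (rule from_compl[OF S(1) S'(1,3)])
    show "ladj A T (?f T')" by (rule from_compl[OF T(1) T'(1,3)])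
    have "?f S' \<in> layers n A" "?f T' \<in> layers n A"
      using compl_layer[OF S'(1)] compl_layer[OF T'(1)] B(2) by blast+
    then show "?f S' \<in> {S \<in> layers n A. n \<notin> S}" "?f T' \<in> {S \<in> layers n A. n \<notin> S}"
      using S'(2) T'(2) by simp_all
  qed
qed

lemma layers_Suc_without: "{S \<in> layers (Suc m) A. Suc m \<notin> S} = layers m A"
proof -
  have "S \<subseteq> {1..Suc m} \<and> Suc m \<notin> S \<longleftrightarrow> S \<subseteq> {1..m}" for S
    by (auto simp: atLeastAtMostSuc_conv)
  then show ?thesis unfolding layers_def by blast
qed

lemma layers_Suc_with:
  "{S \<in> layers (Suc m) A. Suc m \<in> S} = insert (Suc m) ` layers m {k. Suc k \<in> A}" (is "?L = ?R")
proof (intro equalityI subsetI)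
  fix S assume "S \<in> ?L"
  then have S: "S \<in> layers (Suc m) A" "Suc m \<in> S" by auto
  have "S - {Suc m} \<subseteq> {1..m}" using layersD(1)[OF S(1)] by (auto simp: atLeastAtMostSuc_conv)
  moreover have "Suc (card (S - {Suc m})) = card S"
    using card_Suc_Diff1[OF layersD(2)[OF S(1)] S(2)] .
  ultimately have "S - {Suc m} \<in> layers m {k. Suc k \<in> A}"
    using layersD(3)[OF S(1)] by (simp add: layers_def)
  moreover have "S = insert (Suc m) (S - {Suc m})" using S by auto
  ultimately show "S \<in> ?R" by blast
next
  fix S assume "S \<in> ?R"
  then obtain T where T: "T \<in> layers m {k. Suc k \<in> A}" "S = insert (Suc m) T" by blast
  then have "Suc m \<notin> T" using layersD(1)[OF T(1)] by auto
  then have "card S = Suc (card T)" using T(2) layersD(2)[OF T(1)] by simp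
  then show "S \<in> ?L" using T layersD[OF T(1)] by (auto simp: layers_def)
qed

lemma ladj_insert:
  assumes "ladj {k. Suc k \<in> A} S T" "finite S" "finite T" "z \<notin> S" "z \<notin> T"
  shows "ladj A (insert z S) (insert z T)"
proof -
  have c: "consec A (Suc k) (Suc l)" if "consec {k. Suc k \<in> A} k l" for k l
    unfolding consec_def
  proof (intro conjI ballI)
    fix j assume "j \<in> A"
    then show "\<not> (Suc k < j \<and> j < Suc l)" using that by (cases j) (auto simp: consec_def)
  qed (use that in \<open>auto simp: consec_def\<close>)
  have i: "insert z S \<inter> insert z T = insert z (S \<inter> T)" by auto
  consider "card S = card T" "Suc (card (S \<inter> T)) = card S" | "S \<subset> T" "consec {k. Suc k \<in> A} (card S) (card T)"
    | "T \<subset> S" "consec {k. Suc k \<in> A} (card T) (card S)" using assms(1) unfolding ladj_def by blast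
  then show ?thesis
  proof cases
    case 1
    then have "card (insert z S) = card (insert z T)"
      "Suc (card (insert z S \<inter> insert z T)) = card (insert z S)"
      unfolding i using assms(2-5) by simp_all
    then show ?thesis by (simp add: ladj_def)
  next
    case 2
    then show ?thesis using assms(2-5) c by (intro ladj_consec) auto
  next
    case 3
    then have "ladj A (insert z T) (insert z S)" using assms(2-5) c by (intro ladj_consec) auto
    then show ?thesis by (rule sympD[OF symp_ladj])
  qed
qed

text \<open>The inductive step. Both halves belong to the family over \<open>m\<close>, so what is
  left is to supply four vertices \<open>f i\<close> containing \<open>n\<close> with distinct sets
  \<open>N i\<close> of neighbours on the other side. The levels \<open>l\<close> and
  \<open>l'\<close> provide the detours upwards and downwards and may coincide.\<close>

lemma linkable_layers_Suc:
  fixes f :: "'i \<Rightarrow> nat set"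
  assumes IH: "\<And>A. linkable (ladj A) (layers m A)" and n: "n = Suc m"
    and l: "l \<in> A" "2 \<le> l" "l \<le> n" and l': "l' \<in> A" "l' + 2 \<le> n"
    and I: "card I \<ge> 4" "inj_on f I" "\<And>i. i \<in> I \<Longrightarrow> f i \<in> layers n A \<and> n \<in> f i"
    and N: "inj_on N I" "\<And>i. i \<in> I \<Longrightarrow> card (N i) \<ge> 3"
      "\<And>i S. i \<in> I \<Longrightarrow> S \<in> N i \<Longrightarrow> S \<in> layers n A \<and> n \<notin> S \<and> ladj A S (f i)"
  shows "linkable (ladj A) (layers n A)"
proof -
  let ?V0 = "{S \<in> layers n A. n \<notin> S}" and ?V1 = "{S \<in> layers n A. n \<in> S}"
  have lk0: "linkable (ladj A) ?V0" unfolding n layers_Suc_without by (rule IH)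
  have notin: "Suc m \<notin> S" if "S \<in> layers m C" for S C using layersD(1)[OF that] by auto
  have lk1: "linkable (ladj A) ?V1"
    unfolding n layers_Suc_with
  proof (rule linkable_image[OF IH])
    show "inj_on (insert (Suc m)) (layers m {k. Suc k \<in> A})"
      by (rule inj_onI) (use notin in \<open>metis insert_ident\<close>)
    fix S T assume ST: "S \<in> layers m {k. Suc k \<in> A}" "T \<in> layers m {k. Suc k \<in> A}" "ladj {k. Suc k \<in> A} S T"
    show "ladj A (insert (Suc m) S) (insert (Suc m) T)"
      by (rule ladj_insert[OF ST(3) layersD(2)[OF ST(1)] layersD(2)[OF ST(2)] notin[OF ST(1)] notin[OF ST(2)]])
  qed
  \<comment> \<open>\<open>bridged_by_neighbourhoods\<close> indexes neighbour sets by vertices, so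
    the index is recovered from the vertex.\<close>
  have inv: "inv_into I f (f i) = i" if "i \<in> I" for i using I(2) that by (rule inv_into_f_f)
  have "bridged (ladj A) ?V0 ?V1 \<and> bridged (ladj A) ?V1 ?V0"
  proof (rule bridged_by_neighbourhoods[OF symp_ladj, where B = "f ` I" and N = "\<lambda>b. N (inv_into I f b)"])
    show "f ` I \<subseteq> ?V1" using I(3) by blast
    show "card (f ` I) \<ge> 4" using I(1,2) by (simp add: card_image)
    show "inj_on (\<lambda>b. N (inv_into I f b)) (f ` I)"
    proof (rule inj_onI, elim imageE)
      fix b c i j assume "N (inv_into I f b) = N (inv_into I f c)" "b = f i" "c = f j" "i \<in> I" "j \<in> I"
      then show "b = c" using inj_onD[OF N(1), of i j] inv by simp
    qed
    show "finite ?V0" using finite_layers by simp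
  next
    fix b assume "b \<in> f ` I"
    then obtain i where i: "i \<in> I" "b = f i" by blast
    have e: "N (inv_into I f b) = N i" using inv[OF i(1)] i(2) by simp
    show "N (inv_into I f b) \<subseteq> ?V0" unfolding e using N(3)[OF i(1)] by blast
    show "card (N (inv_into I f b)) \<ge> 3" unfolding e by (rule N(2)[OF i(1)])
    show "ladj A a b" if "a \<in> N (inv_into I f b)" for a
      using N(3)[OF i(1)] that i(2) unfolding e by blast
  next
    fix S T assume "S \<in> ?V0" "T \<in> ?V0" "S \<noteq> T" "ladj A S T"
    then show "\<exists>S'\<in>?V1. \<exists>T'\<in>?V1. S' \<noteq> T' \<and> ladj A S S' \<and> ladj A T T'"
      using l by (intro layers_lift_up) auto
  next
    fix S T assume "S \<in> ?V1" "T \<in> ?V1" "S \<noteq> T" "ladj A S T"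
    then show "\<exists>S'\<in>?V0. \<exists>T'\<in>?V0. S' \<noteq> T' \<and> ladj A S S' \<and> ladj A T T'"
      using l' by (intro layers_lift_down) auto
  qed
  moreover have "?V0 \<inter> ?V1 = {}" by blast
  moreover have "finite (?V0 \<union> ?V1)" using finite_layers by simp
  ultimately have "linkable (ladj A) (?V0 \<union> ?V1)"
    using symp_ladj lk0 lk1 by (intro linkable_union) auto
  moreover have "?V0 \<union> ?V1 = layers n A" by blast
  ultimately show ?thesis by simp
qed

section \<open>Neighbourhood families for the inductive step\<close>

lemma le_choose:
  assumes "1 \<le> j" "j < m"
  shows "m \<le> m choose j"
  using assms
proof (induction m arbitrary: j)
  case (Suc m)
  then obtain i where i: "j = Suc i" by (cases j) auto
  show ?case
  proof (cases "j = m")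
    case True
    then show ?thesis using binomial_symmetric[of 1 "Suc m"] Suc by simp
  next
    case False
    then have "m \<le> m choose j" using Suc by simp
    moreover have "1 \<le> m choose i" using i Suc.prems by (simp add: Suc_le_eq zero_less_binomial)
    ultimately show ?thesis unfolding i binomial_Suc_Suc by linarith
  qed
qed simp

text \<open>The vertices are \<open>insert n T\<close> with \<open>T\<close> of size
  \<open>k - 1\<close>; the chosen neighbours replace \<open>n\<close> by some \<open>b\<close>
  outside \<open>T\<close>. There are \<open>n - k \<ge> 3\<close> such \<open>b\<close>, and at
  least \<open>m \<ge> 4\<close> sets \<open>T\<close>.\<close>

lemma linkable_layers_middle:
  assumes IH: "\<And>A. linkable (ladj A) (layers m A)" and n: "n = Suc m"
    and k: "k \<in> A" "2 \<le> k" "k + 3 \<le> n"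
  shows "linkable (ladj A) (layers n A)"
proof (rule linkable_layers_Suc[OF IH n k(1,2) _ k(1), where I = "{T. T \<subseteq> {1..m} \<and> card T = k - 1}"
      and f = "insert n" and N = "\<lambda>T. (\<lambda>b. insert b T) ` ({1..m} - T)"])
  let ?I = "{T. T \<subseteq> {1..m} \<and> card T = k - 1}"
  show "k \<le> n" "k + 2 \<le> n" using k by auto
  have "m \<le> m choose (k - 1)" by (rule le_choose) (use k n in auto)
  then show "card ?I \<ge> 4" using card_layer[of m "k - 1"] k n by simp
  have nT: "n \<notin> T" "finite T" if "T \<in> ?I" for T using that n finite_subset[of T "{1..m}"] by auto
  show "inj_on (insert n) ?I" by (rule inj_onI) (use nT in \<open>metis insert_ident\<close>)
  have cT: "card ({1..m} - T) \<ge> 3" if "T \<in> ?I" for T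
    using that nT[OF that] k n by (simp add: card_Diff_subset)
  show "inj_on (\<lambda>T. (\<lambda>b. insert b T) ` ({1..m} - T)) ?I"
  \<comment> \<open>\<open>T\<close> is the intersection of the sets \<open>insert b T\<close>; two
    of them already meet in \<open>T\<close>.\<close>
  proof (rule inj_on_inverseI[where g = Inter])
    fix T assume T: "T \<in> ?I"
    have "length ([] :: nat list) < card ({1..m} - T)" using cT[OF T] by simp
    then obtain a where a: "a \<in> {1..m} - T" "a \<notin> set []" by (rule ex_avoiding)
    have "length [a] < card ({1..m} - T)" using cT[OF T] by simp
    then obtain b where b: "b \<in> {1..m} - T" "b \<notin> set [a]" by (rule ex_avoiding)
    have "\<Inter> ((\<lambda>b. insert b T) ` ({1..m} - T)) \<subseteq> insert a T \<inter> insert b T"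
      by (intro Int_greatest INT_lower a b)
    also have "\<dots> = T" using b by auto
    finally show "\<Inter> ((\<lambda>b. insert b T) ` ({1..m} - T)) = T" by (intro equalityI INT_greatest) auto
  qed
  fix T assume T: "T \<in> ?I"
  have "insert n T \<subseteq> {1..n}" using T n by auto
  moreover have cn: "card (insert n T) = k" using T nT[OF T] k by simp
  ultimately show "insert n T \<in> layers n A \<and> n \<in> insert n T" using k by (simp add: layers_def)
  have "inj_on (\<lambda>b. insert b T) ({1..m} - T)" by (rule inj_onI) auto
  then show "card ((\<lambda>b. insert b T) ` ({1..m} - T)) \<ge> 3" using cT[OF T] by (simp add: card_image)
  fix S assume "S \<in> (\<lambda>b. insert b T) ` ({1..m} - T)"
  then obtain b where b: "b \<in> {1..m}" "b \<notin> T" "S = insert b T" by blast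
  have cS: "card S = k" using b T nT[OF T] k by simp
  have "n \<notin> S" using b nT[OF T] n by auto
  moreover have "S \<inter> insert n T = T" using b \<open>n \<notin> S\<close> by auto
  then have "ladj A S (insert n T)" using cS cn T k by (simp add: ladj_def)
  moreover have "S \<subseteq> {1..n}" using b T n by auto
  ultimately show "S \<in> layers n A \<and> n \<notin> S \<and> ladj A S (insert n T)" using cS k by (simp add: layers_def)
qed

lemma ladj_singletons: "a \<noteq> b \<Longrightarrow> ladj A {a} {b}"
  by (simp add: ladj_def)

text \<open>The vertices are \<open>{i, n}\<close>, where \<open>i = n\<close> stands for
  \<open>{n}\<close>. The chosen neighbours of \<open>{n}\<close> are the other singletons; those of
  \<open>{i, n}\<close> are the sets \<open>{i, t}\<close> with \<open>t \<le> m\<close>, where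
  \<open>t = i\<close> gives \<open>{i}\<close> on level 1.\<close>

lemma linkable_layers_1_2:
  assumes IH: "\<And>A. linkable (ladj A) (layers m A)" and n: "n = Suc m" "4 \<le> n"
    and A: "1 \<in> A" "2 \<in> A"
  shows "linkable (ladj A) (layers n A)"
proof -
  define N where
    "N i = (if i = n then (\<lambda>s. {s}) ` {1..m} else (\<lambda>t. {i, t}) ` {1..m})" for i
  define f where "f i = {i, n}" for i
  have c12: "consec A 1 2" using A by (auto simp: consec_def)
  show ?thesis
  proof (rule linkable_layers_Suc[OF IH n(1) A(2) _ _ A(1), where I = "{1..n}" and f = f and N = N])
    show "inj_on f {1..n}" by (rule inj_onI) (auto simp: f_def doubleton_eq_iff)
    show "inj_on N {1..n}"
    proof (rule inj_onI)
      fix i j assume ij: "i \<in> {1..n}" "j \<in> {1..n}" "N i = N j"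
      \<comment> \<open>For \<open>i \<le> m\<close> all sets in \<open>N i\<close> contain
        \<open>i\<close>, and \<open>{i}\<close> is one of them, so \<open>N i\<close> determines
        \<open>i\<close>; a two-element member separates it from \<open>N n\<close>.\<close>
      have diff: "i = j" if "i \<in> {1..m}" "j \<in> {1..n}" "N i = N j" for i j
      proof (cases "j = n")
        case True
        obtain t where "t \<in> {1..m}" "t \<notin> set [i]" using ex_avoiding[of "[i]" "{1..m}"] n by auto
        then have "{i, t} \<in> N i" "i \<noteq> t" using that n by (auto simp: N_def)
        then have "{i, t} \<in> (\<lambda>s. {s}) ` {1..m}" using that(3) True by (simp add: N_def)
        then show ?thesis using \<open>i \<noteq> t\<close> by (auto simp: doubleton_eq_iff)
      next
        case False
        have "{i, i} \<in> N i" using that n by (auto simp: N_def)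
        then have "{i, i} \<in> (\<lambda>t. {j, t}) ` {1..m}" using that(3) False by (simp add: N_def)
        then show ?thesis by auto
      qed
      show "i = j"
      proof (cases "i = n")
        case True
        then show ?thesis using diff[of j i] ij n by (cases "j = n") auto
      next
        case False
        then show ?thesis using diff[of i j] ij n by auto
      qed
    qed
    fix i assume i: "i \<in> {1..n}"
    have "card (f i) = (if i = n then 1 else 2)" by (simp add: f_def)
    then show "f i \<in> layers n A \<and> n \<in> f i" using i A by (auto simp: layers_def f_def)
    have "card (N i) = m"
      unfolding N_def by (auto simp: card_image inj_on_def doubleton_eq_iff)
    then show "card (N i) \<ge> 3" using n by simp
    fix S assume S: "S \<in> N i"
    show "S \<in> layers n A \<and> n \<notin> S \<and> ladj A S (f i)"
    proof (cases "i = n")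
      case True
      then obtain s where s: "s \<in> {1..m}" "S = {s}" using S by (auto simp: N_def)
      moreover have "f i = {n}" using True by (simp add: f_def)
      ultimately show ?thesis using A n ladj_singletons[of s n A] by (auto simp: layers_def)
    next
      case False
      then obtain t where t: "t \<in> {1..m}" "S = {i, t}" using S by (auto simp: N_def)
      have i': "i \<noteq> n" "i \<in> {1..m}" using False i n by auto
      show ?thesis
      proof (cases "t = i")
        case True
        have "consec A (card {i}) (card {i, n})" using c12 i'(1) by (simp add: numeral_2_eq_2)
        then have "ladj A {i} {i, n}" by (intro ladj_consec) auto
        then show ?thesis using t i' n A True by (auto simp: layers_def f_def)
      next
        case False
        have single: "{i, t} \<inter> {i, n} = {i}" using t i' False n by auto
        have "card ({i, t} \<inter> {i, n}) = 1" unfolding single by simp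
        moreover have c2: "card {i, t} = 2" "card {i, n} = 2" using False i'(1) by simp_all
        ultimately have "ladj A {i, t} {i, n}" unfolding ladj_def by linarith
        moreover note c2(1)
        ultimately show ?thesis using t i' n A by (auto simp: layers_def f_def)
      qed
    qed
  qed (use n in auto)
qed

text \<open>The vertices are \<open>{n}\<close> and the sets of size \<open>m\<close> that miss one
  \<open>i \<le> m\<close>. No level lies between 1 and \<open>m\<close>, so the latter are adjacent
  to the singletons they contain; \<open>{1..m}\<close> is a further neighbour, obtained by
  exchanging \<open>n\<close> for \<open>i\<close>. Each vertex thus gets \<open>m\<close> chosen
  neighbours.\<close>

lemma linkable_layers_1_pred:
  assumes IH: "\<And>A. linkable (ladj A) (layers m A)" and n: "n = Suc m" "4 \<le> n"
    and A: "1 \<in> A" "m \<in> A" "\<And>j. j \<in> A \<Longrightarrow> \<not> (1 < j \<and> j < m)"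
  shows "linkable (ladj A) (layers n A)"
proof -
  define N where
    "N i = (if i = n then (\<lambda>s. {s}) ` {1..m} else insert {1..m} ((\<lambda>t. {t}) ` ({1..m} - {i})))" for i
  define f where "f i = (if i = n then {n} else {1..n} - {i})" for i
  have c: "consec A 1 m" using A n by (auto simp: consec_def)
  have big: "{1..m} \<noteq> {t}" for t
  proof
    assume "{1..m} = {t}"
    then have "card {1..m} = 1" by simp
    then show False using n by simp
  qed
  show ?thesis
  proof (rule linkable_layers_Suc[OF IH n(1) A(2) _ _ A(1), where I = "{1..n}" and f = f and N = N])
    have fc: "card (f i) = (if i = n then 1 else m)" if "i \<in> {1..n}" for i
      using that n by (simp add: f_def)
    show "inj_on f {1..n}"
    proof (rule inj_onI)
      fix i j assume ij: "i \<in> {1..n}" "j \<in> {1..n}" "f i = f j"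
      have "i = n \<longleftrightarrow> j = n"
        using fc[OF ij(1)] fc[OF ij(2)] n unfolding ij(3) by (cases "i = n"; cases "j = n") simp_all
      moreover have "i = j" if "i \<noteq> n" "j \<noteq> n"
      proof -
        have "{1..n} - {i} = {1..n} - {j}" using ij(3) that by (simp add: f_def)
        then show ?thesis using ij(1,2) by blast
      qed
      ultimately show "i = j" by blast
    qed
    show "inj_on N {1..n}"
    proof (rule inj_onI)
      fix i j assume ij: "i \<in> {1..n}" "j \<in> {1..n}" "N i = N j"
      \<comment> \<open>The index is read off from \<open>N i\<close>: the set \<open>{1..m}\<close>
        is absent exactly for \<open>i = n\<close>, and otherwise \<open>{i}\<close> is the missing
        singleton.\<close>
      have top: "{1..m} \<in> N i \<longleftrightarrow> i \<noteq> n" for i using big n by (auto simp: N_def)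
      have sing: "{t} \<in> N i \<longleftrightarrow> t \<in> {1..m} \<and> t \<noteq> i" if "i \<noteq> n" for t i
        unfolding N_def using big[of t] that by (simp only: if_False) blast
      have "i = n \<longleftrightarrow> j = n" using top[of i] top[of j] ij by simp
      then show "i = j" using sing[of i i] sing[of j i] ij n by auto
    qed
    fix i assume i: "i \<in> {1..n}"
    have "f i \<subseteq> {1..n}" "n \<in> f i" using i by (auto simp: f_def)
    then show "f i \<in> layers n A \<and> n \<in> f i" using fc[OF i] A by (simp add: layers_def)
    have "card (N i) = m"
    proof (cases "i = n")
      case False
      have "card ((\<lambda>t. {t}) ` ({1..m} - {i})) = m - 1" using i n False by (simp add: card_image)
      moreover have "{1..m} \<notin> (\<lambda>t. {t}) ` ({1..m} - {i})" using big by blast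
      ultimately show ?thesis using False n by (simp add: N_def)
    qed (simp add: N_def card_image)
    then show "card (N i) \<ge> 3" using n by simp
    fix S assume S: "S \<in> N i"
    have single: "{t} \<in> layers n A \<and> n \<notin> {t}" if "t \<in> {1..m}" for t
      using that n A by (auto simp: layers_def)
    show "S \<in> layers n A \<and> n \<notin> S \<and> ladj A S (f i)"
    proof (cases "i = n")
      case True
      then obtain s where s: "s \<in> {1..m}" "S = {s}" using S by (auto simp: N_def)
      moreover have "f i = {n}" using True by (simp add: f_def)
      ultimately show ?thesis using single[OF s(1)] ladj_singletons[of s n A] n by auto
    next
      case False
      then have i': "i \<in> {1..m}" using i n by auto
      have fi: "f i = {1..n} - {i}" using False by (simp add: f_def)
      consider "S = {1..m}" | t where "t \<in> {1..m}" "t \<noteq> i" "S = {t}"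
        using S False unfolding N_def by (simp only: if_False) blast
      then show ?thesis
      proof cases
        case 1
        have *: "{1..m} \<inter> f i = {1..m} - {i}" unfolding fi n(1) by auto
        have "Suc (card ({1..m} \<inter> f i)) = m" unfolding * using i' n by simp
        moreover have "card (f i) = m" using fc[OF i] False by simp
        ultimately have "ladj A S (f i)" using 1 by (simp add: ladj_def)
        moreover have "S \<in> layers n A" "n \<notin> S" using 1 n A by (auto simp: layers_def)
        ultimately show ?thesis by blast
      next
        case 2
        have "S \<subseteq> f i" unfolding fi n(1) using 2 by auto
        moreover have "consec A (card S) (card (f i))" using c fc[OF i] False 2 by simp
        ultimately have "ladj A S (f i)" by (rule ladj_consec)
        then show ?thesis using single[OF 2(1)] 2 by simp
      qed
    qed
  qed (use n in auto)
qed

text \<open>For \<open>n = 3\<close> the search settles the level sets containing 1 and 2, and the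
  others are nearly complete. For larger \<open>n\<close> the cases are: some level from 2 to
  \<open>n - 2\<close>, with \<open>n = 4\<close> apart; both 1 and \<open>n - 1\<close> with
  nothing between; extreme levels only.\<close>

lemma linkable_layers: "n \<ge> 3 \<Longrightarrow> linkable (ladj A) (layers n A)"
proof (induction n arbitrary: A rule: nat_induct_at_least)
  case base
  show ?case
  proof (cases "1 \<in> A \<and> 2 \<in> A")
    case True
    then show ?thesis using linkable_layers_3_middle by blast
  next
    case False
    show ?thesis
    proof (rule linkable_layers_extreme)
      fix k assume "k \<in> A" "k \<le> (3::nat)"
      then show "k \<in> {0, 1, 3 - 1, 3}" by auto
    qed (use False in auto)
  qed
next
  case (Suc m)
  note IH = Suc.IH
  define n where "n = Suc m"
  have n: "n = Suc m" "4 \<le> n" using Suc by (auto simp: n_def)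
  \<comment> \<open>The reflected level set. It reduces \<open>k = n - 2\<close> to level 2 and, for
    \<open>n = 4\<close>, level 3 to level 1.\<close>
  define C where "C A = {k. k \<le> n \<and> n - k \<in> A}" for A
  have compl: "linkable (ladj A) (layers n A)" if "linkable (ladj (C A)) (layers n (C A))" for A
    by (rule linkable_layers_compl[OF that]) (simp add: C_def)
  have "linkable (ladj A) (layers n A)"
  proof (cases "\<exists>k\<in>A. 2 \<le> k \<and> k + 2 \<le> n")
    case True
    then obtain k where k: "k \<in> A" "2 \<le> k" "k + 2 \<le> n" by blast
    show ?thesis
    proof (cases "n = 4")
      case False
      show ?thesis
      proof (cases "k + 3 \<le> n")
        case True
        then show ?thesis using linkable_layers_middle[OF IH n(1) k(1,2)] by blast
      next
        case False
        then have "n - 2 = k" using k by simp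
        then have "2 \<in> C A" "2 + 3 \<le> n" using k \<open>n \<noteq> 4\<close> n by (auto simp: C_def)
        then have "linkable (ladj (C A)) (layers n (C A))"
          using linkable_layers_middle[OF IH n(1), of 2] by blast
        then show ?thesis by (rule compl)
      qed
    next
      case n4: True
      then have A2: "2 \<in> A" using k by (metis add_le_cancel_right le_antisym numeral_Bit0)
      consider "1 \<in> A" | "3 \<in> A" | "1 \<notin> A" "3 \<notin> A" by blast
      then show ?thesis
      proof cases
        case 1
        then show ?thesis using linkable_layers_1_2[OF IH n] A2 by blast
      next
        case 2
        then have "1 \<in> C A" "2 \<in> C A" using A2 n4 by (simp_all add: C_def)
        then have "linkable (ladj (C A)) (layers n (C A))"
          using linkable_layers_1_2[OF IH n] by blast
        then show ?thesis by (rule compl)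
      next
        case 3
        then show ?thesis using linkable_layers_4_even A2 n4 by blast
      qed
    qed
  next
    case False
    show ?thesis
    proof (cases "1 \<in> A \<and> m \<in> A")
      case True
      have gap: "\<not> (1 < j \<and> j < m)" if "j \<in> A" for j
        using False that n by (metis Suc_leI add_2_eq_Suc' Suc_le_mono Suc_1)
      show ?thesis by (rule linkable_layers_1_pred[OF IH n]) (use True gap in blast)+
    next
      case nb: False
      show ?thesis
      proof (rule linkable_layers_extreme)
        show "1 \<notin> A \<or> n - 1 \<notin> A" using nb n by auto
        fix k assume "k \<in> A" "k \<le> n"
        then have "\<not> (2 \<le> k \<and> k + 2 \<le> n)" using False by blast
        then show "k \<in> {0, 1, n - 1, n}" using \<open>k \<le> n\<close> by auto
      qed (use n in auto)
    qed
  qed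
  then show ?case by (simp add: n_def)
qed

section \<open>Back to QJ(n, A)\<close>

lemma lev_mem: "finite A \<Longrightarrow> i < card A \<Longrightarrow> lev A i \<in> A"
  unfolding lev_def
  using nth_mem[of i "sorted_list_of_set A"] by (simp add: length_sorted_list_of_set)

lemma lev_surj:
  assumes "finite A" "k \<in> A"
  obtains i where "i < card A" "lev A i = k"
proof -
  have "k \<in> set (sorted_list_of_set A)" using assms by simp
  then show thesis using that unfolding in_set_conv_nth lev_def by auto
qed

lemma lev_strict_mono:
  assumes "finite A" "i < j" "j < card A"
  shows "lev A i < lev A j"
  using assms strict_sorted_list_of_set[of A] unfolding lev_def
  by (simp add: sorted_wrt_iff_nth_less)

text \<open>An index strictly between those of \<open>k\<close> and \<open>l\<close> would give an
  element of \<open>A\<close> strictly between them.\<close>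

lemma lev_consec:
  assumes "finite A" "consec A k l"
  obtains i where "Suc i < card A" "lev A i = k" "lev A (Suc i) = l"
proof -
  obtain i where i: "i < card A" "lev A i = k" using assms lev_surj consec_def by metis
  obtain j where j: "j < card A" "lev A j = l" using assms lev_surj consec_def by metis
  have kl: "k < l" using assms(2) by (simp add: consec_def)
  have "i < j"
  proof (rule ccontr)
    assume "\<not> i < j"
    then consider "j = i" | "j < i" by linarith
    then show False using lev_strict_mono[OF assms(1), of j i] i j kl by cases auto
  qed
  moreover have "\<not> Suc i < j"
  proof
    assume s: "Suc i < j"
    then have "k < lev A (Suc i)" "lev A (Suc i) < l" "lev A (Suc i) \<in> A"
      using lev_strict_mono[OF assms(1), of i "Suc i"] lev_strict_mono[OF assms(1), of "Suc i" j]
        lev_mem[OF assms(1), of "Suc i"] i j by auto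
    then show False using assms(2) by (simp add: consec_def)
  qed
  ultimately have "j = Suc i" by simp
  then show thesis using that i j by blast
qed

lemma QJ_verts_layers: "finite A \<Longrightarrow> QJ_verts n A = layers n A"
  unfolding QJ_verts_def layers_def johnson_verts_def
  by (auto dest: lev_mem elim: lev_surj) (metis lev_surj lessThan_iff)

text \<open>This inclusion of edges is what turns paths of the layered graph into paths of
  \<open>QJ(n, A)\<close>.\<close>

lemma ladj_imp_QJ_adj:
  assumes A: "finite A" and S: "S \<in> layers n A" and T: "T \<in> layers n A" and "ladj A S T"
  shows "QJ_adj n A S T"
proof -
  have SJ: "S \<in> johnson_verts n (card S)" and TJ: "T \<in> johnson_verts n (card T)"
    using layersD(1)[OF S] layersD(1)[OF T] by (simp_all add: johnson_verts_def)
  consider "card S = card T" "Suc (card (S \<inter> T)) = card S" | "S \<subset> T" "consec A (card S) (card T)"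
    | "T \<subset> S" "consec A (card T) (card S)" using assms(4) unfolding ladj_def by blast
  then show ?thesis
  proof cases
    case 1
    obtain i where i: "i < card A" "lev A i = card S" using lev_surj[OF A layersD(3)[OF S]] .
    have "S \<noteq> T" using 1 by auto
    moreover have "card (S \<inter> T) = card S - 1" using 1(2) by linarith
    ultimately have "johnson_adj (lev A i) S T" using i by (simp add: johnson_adj_def)
    then show ?thesis unfolding QJ_adj_def using i SJ TJ 1(1) by metis
  next
    case 2
    obtain i where "Suc i < card A" "lev A i = card S" "lev A (Suc i) = card T"
      using lev_consec[OF A 2(2)] .
    then show ?thesis unfolding QJ_adj_def using SJ TJ psubset_imp_subset[OF 2(1)] by metis
  next
    case 3
    obtain i where "Suc i < card A" "lev A i = card T" "lev A (Suc i) = card S"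
      using lev_consec[OF A 3(2)] .
    then show ?thesis unfolding QJ_adj_def using SJ TJ psubset_imp_subset[OF 3(1)] by metis
  qed
qed

lemma linkable_imp_paired_2_coverable:
  assumes "linkable F V" "\<And>a b. a \<in> V \<Longrightarrow> b \<in> V \<Longrightarrow> F a b \<Longrightarrow> E a b"
  shows "paired_2_coverable V E"
  unfolding paired_2_coverable_def
proof (intro ballI impI)
  have path: "\<exists>P. is_path V E P \<and> hd P = a \<and> last P = b \<and> set P = W"
    if h: "ham F W a b" and W: "W \<subseteq> V" for W a b
  proof -
    from h obtain P where P: "P \<noteq> [] \<and> distinct P \<and> set P = W \<and> successively F P \<and> hd P = a \<and> last P = b"
      unfolding ham_def ..
    then have F: "successively F P" by blast
    have "successively E P"
    proof (rule successively_mono[OF F])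
      fix a b assume "a \<in> set P" "b \<in> set P" "F a b"
      then show "E a b" using assms(2) P W by blast
    qed
    then have "is_path V E P" using P W by (simp add: is_path_def successively_conv_nth)
    then show ?thesis using P by blast
  qed
  fix u v x y assume "u \<in> V" "v \<in> V" "x \<in> V" "y \<in> V" "distinct [u, v, x, y]"
  then have "ham2 F V u v x y" by (rule linkable_ham2[OF assms(1)])
  then obtain W W' where W: "ham F W u v" "ham F W' x y" "W \<inter> W' = {}" "V = W \<union> W'" by (rule ham2E)
  obtain P Q where "is_path V E P" "hd P = u" "last P = v" "set P = W"
    "is_path V E Q" "hd Q = x" "last Q = y" "set Q = W'"
    using path[OF W(1)] path[OF W(2)] W(4) by (metis sup_ge1 sup_ge2)
  then show "\<exists>P Q. is_path V E P \<and> is_path V E Q \<and> hd P = u \<and> last P = v \<and> hd Q = x \<and> last Q = y \<and>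
      set P \<inter> set Q = {} \<and> set P \<union> set Q = V"
    using W(3,4) by (intro exI[of _ P] exI[of _ Q]) auto
qed

theorem theorem9:
  fixes n :: nat and A :: "nat set"
  assumes "n \<ge> 4" and "A \<noteq> {}" and "A \<subseteq> {1..n}"
    and "card (QJ_verts n A) \<ge> 4"
  shows "paired_2_coverable (QJ_verts n A) (QJ_adj n A)"
proof -
  have A: "finite A" using assms(3) finite_subset by blast
  have "linkable (ladj A) (layers n A)" using linkable_layers assms(1) by simp
  then show ?thesis
    unfolding QJ_verts_layers[OF A]
    by (rule linkable_imp_paired_2_coverable) (rule ladj_imp_QJ_adj[OF A])
qed

end
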